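(* (i) There is an absolute constant $C>0$ such that for every integer $N\geq 10$ there exist a uniformly convex sequence $\{a_n\}_{n=1}^N$ (with parameter $N$) and a sequence of complex numbers $\{b_n\}_{n=1}^N$ such that \[ \left\| \sup_{x\in [0,N]} \left|\sum_{n=1}^N b_n e \left(x\frac{n}{N} + ta_n \right) \right| \right\|_{L^4([0,N^2])} \geq C N^{\frac{5}{8}} \Big(\sum_{n=1}^N |b_n|^2\Big)^{1/2}, \] where the $L^4([0,N^2])$ norm is taken in the variable $t$. (ii) For every $\epsilon>0$ there exists $C_\epsilon>0$ such that for every integer $N\geq 1$, every uniformly convex sequence $\{a_n\}_{n=1}^N$ (with parameter $N$) and every sequence of complex numbers $\{b_n\}_{n=1}^N$, \[ \left\| \sup_{x\in [0,N]} \left|\sum_{n=1}^N b_n e \left(x\frac{n}{N} + ta_n \right) \right| \right\|_{L^4([0,N^2])} \leq C_\epsilon N^\epsilon N^{\frac{2}{3}} \Big(\sum_{n=1}^N |b_n|^2\Big)^{1/2}. \]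
   Context: $e(x):=e^{2\pi i x}$. A real sequence $\{a_n\}_{n=1}^N$ is called uniformly convex (with parameter $N$) if for all admissible $n$: $a_{n+1}-a_n\in[\frac{1}{4N},\frac{4}{N}]$ and $(a_{n+2}-a_{n+1})-(a_{n+1}-a_n)\in[\frac{1}{4N^2},\frac{4}{N^2}]$. *)

theory Defs
  imports "HOL-Analysis.Analysis"
begin

definition e :: "real \<Rightarrow> complex" where
  "e x = exp (complex_of_real (2 * pi * x) * \<i>)"

definition uniformly_convex :: "nat \<Rightarrow> (nat \<Rightarrow> real) \<Rightarrow> bool" where
  "uniformly_convex N a \<longleftrightarrow>
     (\<forall>n. 1 \<le> n \<and> n + 1 \<le> N \<longrightarrow>
        a (n+1) - a n \<in> {1 / (4 * real N) .. 4 / real N}) \<and>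
     (\<forall>n. 1 \<le> n \<and> n + 2 \<le> N \<longrightarrow>
        (a (n+2) - a (n+1)) - (a (n+1) - a n) \<in> {1 / (4 * (real N)^2) .. 4 / (real N)^2})"

definition maxfun :: "nat \<Rightarrow> (nat \<Rightarrow> real) \<Rightarrow> (nat \<Rightarrow> complex) \<Rightarrow> real \<Rightarrow> real" where
  "maxfun N a b t = (SUP x\<in>{0..real N}.
      cmod (\<Sum>n=1..N. b n * e (x * real n / real N + t * a n)))"

definition L4norm :: "nat \<Rightarrow> (nat \<Rightarrow> real) \<Rightarrow> (nat \<Rightarrow> complex) \<Rightarrow> real" where
  "L4norm N a b = (LINT t:{0..(real N)^2}|lborel. (maxfun N a b t) ^ 4) powr (1/4)"

definition l2norm :: "nat \<Rightarrow> (nat \<Rightarrow> complex) \<Rightarrow> real" where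
  "l2norm N b = sqrt (\<Sum>n=1..N. (cmod (b n))^2)"

end

theory Submission
  imports Defs
begin

text \<open>
  Upper bound: by Hoelder's inequality on the interval of length \<open>N\<^sup>2\<close> it suffices to bound the sixth moment of
  the maximal function by \<open>N powr (3 + \<epsilon>)\<close>. For fixed \<open>t\<close> the sum is a trigonometric polynomial of
  degree at most \<open>N\<close>, so the supremum over \<open>x\<close> costs a factor \<open>N\<close> against the mean over \<open>x\<close>, and
  one is left with the discrete restriction estimate for the points \<open>(n, a n)\<close>, in \<open>L\<^sup>6\<close> with
  \<open>N powr \<epsilon>\<close> loss. It is shown by a bilinear induction on scales. For blocks \<open>I\<close>, \<open>J\<close> at distance
  \<open>H\<close>, with \<open>J\<close> of length \<open>L\<close>, the pieces of \<open>I\<close> of length \<open>L\<^sup>2 / H\<close> are almost orthogonal with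
  respect to the weight \<open>(cmod F\<^sub>J) ^ 4\<close>, because the slope of \<open>a\<close> differs by at least \<open>H\<close> between \<open>I\<close> and
  \<open>J\<close>. Cauchy--Schwarz exchanges the roles of the blocks, so \<open>k\<close> steps gain a factor
  \<open>K powr (- \<epsilon> * k / 2)\<close>, which beats the polynomial loss in \<open>K\<close> of the broad--narrow reduction.

  Lower bound: take \<open>a n = 5 * n / N - c * sqrt (J\<^sup>2 + n)\<close> with \<open>J\<close> about \<open>sqrt N\<close>, and let \<open>b\<close> be the
  indicator of the \<open>n = m\<^sup>2 + 2 * J * m\<close>, for which the root is the integer \<open>J + m\<close>. The choice of
  \<open>x\<close> cancels the linear part, which leaves a Dirichlet kernel in \<open>t\<close> with about \<open>sqrt N\<close> terms and
  period \<open>1 / c\<close>.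
\<close>

section \<open>Broad-narrow dichotomy for finite sums\<close>

lemma sum_pow_le_card_pow:
  fixes f :: "'a \<Rightarrow> real"
  assumes "finite S" "\<And>i. i \<in> S \<Longrightarrow> f i \<ge> 0" "card S \<le> Q" "p > 0"
  shows "(\<Sum>i\<in>S. f i) ^ p \<le> real Q ^ p * (\<Sum>i\<in>S. f i ^ p)"
proof (cases "S = {}")
  case True
  then show ?thesis using assms(4) by (auto simp: zero_power)
next
  case False
  define m where "m = Max (f ` S)"
  have "m \<in> f ` S" unfolding m_def using assms(1) False by (intro Max_in) auto
  then obtain i where i: "i \<in> S" "m = f i" by auto
  have le: "f j \<le> m" if "j \<in> S" for j
    unfolding m_def using assms(1) that by auto
  have "m \<ge> 0" using i assms(2) by auto
  have "(\<Sum>i\<in>S. f i) \<le> real (card S) * m"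
    using sum_bounded_above[of S f m] le by auto
  also have "\<dots> \<le> real Q * m" using assms(3) \<open>m \<ge> 0\<close> by (intro mult_right_mono) auto
  finally have "(\<Sum>i\<in>S. f i) ^ p \<le> (real Q * m) ^ p"
    using assms(2) by (intro power_mono sum_nonneg) auto
  also have "\<dots> = real Q ^ p * f i ^ p" using i by (simp add: power_mult_distrib)
  also have "\<dots> \<le> real Q ^ p * (\<Sum>i\<in>S. f i ^ p)"
    using assms i by (intro mult_left_mono member_le_sum) auto
  finally show ?thesis .
qed

text \<open>Let \<open>m\<close> be the largest modulus, attained at \<open>j\<close>. Either every
  term with index at distance at least 2 from \<open>j\<close> is at most \<open>m / Q\<close>, and
  the sum is at most \<open>4 * m\<close> (narrow case), or some such term exceeds
  \<open>m / Q\<close> and can replace two of the six factors \<open>m\<close> (broad case), which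
  leaves a product of two separated terms.\<close>

lemma broad_narrow:
  fixes f :: "nat \<Rightarrow> complex"
  assumes "finite S" "card S \<le> Q"
  shows "cmod (\<Sum>j\<in>S. f j) ^ 6 \<le> 4 ^ 6 * (\<Sum>j\<in>S. cmod (f j) ^ 6)
     + real Q ^ 8 * (\<Sum>j\<in>S. \<Sum>i\<in>{i\<in>S. i + 2 \<le> j \<or> j + 2 \<le> i}. cmod (f i) ^ 2 * cmod (f j) ^ 4)"
    (is "_ \<le> ?N + ?B")
proof (cases "S = {}")
  case True
  then show ?thesis by auto
next
  case False
  have N0: "?N \<ge> 0" by (intro mult_nonneg_nonneg sum_nonneg) auto
  have B0: "?B \<ge> 0" by (intro mult_nonneg_nonneg sum_nonneg) auto
  have "Q > 0" using assms False by (metis card_gt_0_iff le_zero_eq neq0_conv)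
  define m where "m = Max ((\<lambda>j. cmod (f j)) ` S)"
  have "m \<in> (\<lambda>j. cmod (f j)) ` S" unfolding m_def using assms(1) False by (intro Max_in) auto
  then obtain j where j: "j \<in> S" "m = cmod (f j)" by auto
  have le: "cmod (f i) \<le> m" if "i \<in> S" for i
    unfolding m_def using assms(1) that by auto
  define S' where "S' = {i\<in>S. i + 2 \<le> j \<or> j + 2 \<le> i}"
  have m0: "m \<ge> 0" using j by auto
  have sle: "cmod (sum f S) \<le> (\<Sum>i\<in>S. cmod (f i))" by (rule norm_sum)
  show ?thesis
  proof (cases "\<forall>i\<in>S'. cmod (f i) * real Q \<le> m")
    case True
    have "(\<Sum>i\<in>S. cmod (f i)) = (\<Sum>i\<in>S'. cmod (f i)) + (\<Sum>i\<in>S - S'. cmod (f i))"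
      using assms(1) by (subst sum.subset_diff[of S' S]) (auto simp: S'_def)
    moreover have "(\<Sum>i\<in>S'. cmod (f i)) \<le> m"
    proof -
      have "(\<Sum>i\<in>S'. cmod (f i)) \<le> real (card S') * (m / real Q)"
        using True \<open>Q > 0\<close> by (intro sum_bounded_above) (auto simp: field_simps)
      also have "\<dots> \<le> real Q * (m / real Q)"
      proof (intro mult_right_mono)
        have "card S' \<le> card S" using assms(1) by (intro card_mono) (auto simp: S'_def)
        then show "real (card S') \<le> real Q" using assms by auto
      qed (use m0 in auto)
      finally show ?thesis using \<open>Q > 0\<close> by auto
    qed
    \<comment> \<open>Only \<open>j\<close> and its neighbours remain; with one more
      \<open>m\<close> from all the far terms together this makes the 4 of the narrow term.\<close>
    moreover have "(\<Sum>i\<in>S - S'. cmod (f i)) \<le> 3 * m"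
    proof -
      have "S - S' \<subseteq> {j - 1, j, j + 1}" by (auto simp: S'_def)
      then have "card (S - S') \<le> card {j - 1, j, j + 1}" by (intro card_mono) auto
      also have "\<dots> \<le> 3" by (rule order_trans[OF card_insert_le_m1]) (auto simp: card_insert_if)
      finally have "real (card (S - S')) * m \<le> 3 * m" using m0 by (intro mult_right_mono) auto
      moreover have "(\<Sum>i\<in>S - S'. cmod (f i)) \<le> real (card (S - S')) * m"
        using le by (intro sum_bounded_above) auto
      ultimately show ?thesis by linarith
    qed
    ultimately have "cmod (sum f S) \<le> 4 * m" using sle by linarith
    then have "cmod (sum f S) ^ 6 \<le> (4 * m) ^ 6" by (intro power_mono) auto
    also have "\<dots> = 4 ^ 6 * cmod (f j) ^ 6" using j by (simp add: power_mult_distrib)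
    also have "\<dots> \<le> ?N" using j assms(1) by (intro mult_left_mono member_le_sum) auto
    finally show ?thesis using B0 by linarith
  next
    case False
    then obtain i where i: "i \<in> S'" "m < cmod (f i) * real Q" by auto
    have "cmod (sum f S) \<le> real (card S) * m"
      using sle sum_bounded_above[of S "\<lambda>j. cmod (f j)" m] le by fastforce
    also have "\<dots> \<le> real Q * m" using assms m0 by (intro mult_right_mono) auto
    finally have "cmod (sum f S) ^ 6 \<le> (real Q * m) ^ 6" by (intro power_mono) auto
    also have "\<dots> = real Q ^ 6 * (m ^ 2 * cmod (f j) ^ 4)"
      by (simp add: power_mult_distrib j flip: power_add)
    \<comment> \<open>Trading two factors \<open>m\<close> for the far term costs
      \<open>Q ^ 2\<close>; together with \<open>Q ^ 6\<close> from the crude bound of the sum this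
      is \<open>Q ^ 8\<close>.\<close>
    also have "\<dots> \<le> real Q ^ 6 * ((cmod (f i) * real Q) ^ 2 * cmod (f j) ^ 4)"
      using i m0 by (intro mult_left_mono mult_right_mono power_mono) auto
    also have "\<dots> = real Q ^ 8 * (cmod (f i) ^ 2 * cmod (f j) ^ 4)"
      by (simp add: power_mult_distrib eval_nat_numeral)
    also have "\<dots> \<le> real Q ^ 8 * (\<Sum>i\<in>S'. cmod (f i) ^ 2 * cmod (f j) ^ 4)"
      using i assms(1)
      by (intro mult_left_mono member_le_sum[of i S' "\<lambda>i. cmod (f i) ^ 2 * cmod (f j) ^ 4"])
        (auto simp: S'_def)
    also have "\<dots> \<le> ?B" unfolding S'_def using j assms(1)
      by (intro mult_left_mono member_le_sum[of j S
          "\<lambda>j. \<Sum>i\<in>{i\<in>S. i + 2 \<le> j \<or> j + 2 \<le> i}. cmod (f i) ^ 2 * cmod (f j) ^ 4"])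
        (auto intro!: sum_nonneg)
    finally show ?thesis using N0 by linarith
  qed
qed

section \<open>Blocks of indices, their diameters and their separation\<close>

definition diam_le :: "nat \<Rightarrow> nat set \<Rightarrow> bool" where
  "diam_le L I \<longleftrightarrow> (\<forall>m\<in>I. \<forall>n\<in>I. m \<le> n + L)"

text \<open>The alternative is taken for the sets as a whole, so any two points of \<open>I\<close>
  lie on the same side of any point of \<open>J\<close>. This keeps the sign of slope differences
  constant.\<close>

definition separated :: "nat \<Rightarrow> nat set \<Rightarrow> nat set \<Rightarrow> bool" where
  "separated H I J \<longleftrightarrow> (\<forall>n\<in>I. \<forall>m\<in>J. m + H \<le> n) \<or> (\<forall>n\<in>I. \<forall>m\<in>J. n + H \<le> m)"

definition block :: "nat \<Rightarrow> nat set \<Rightarrow> nat \<Rightarrow> nat set" where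
  "block l I j = {n \<in> I. n div l = j}"

lemma block_subset: "block l I j \<subseteq> I"
  by (auto simp: block_def)

lemma diam_le_block:
  assumes "l > 0"
  shows "diam_le l (block l I j)"
proof -
  have "m \<le> n + l" if "m div l = n div l" for m n :: nat
  proof -
    have "m = n div l * l + m mod l" using that by (metis div_mult_mod_eq)
    moreover have "n div l * l \<le> n" "m mod l < l" using assms by auto
    ultimately show ?thesis by linarith
  qed
  then show ?thesis unfolding diam_le_def block_def by auto
qed

text \<open>Block indices that differ by at least 2 leave a whole grid interval of length
  \<open>l\<close> between the blocks.\<close>

lemma separated_block:
  assumes "l > 0" "i + 2 \<le> j \<or> j + 2 \<le> i"
  shows "separated l (block l I i) (block l I' j)"
proof -
  have *: "m + l \<le> n" if "m div l + 2 \<le> n div l" for m n :: nat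
  proof -
    have "m < m div l * l + l" using dividend_less_div_times[OF assms(1), of m] by simp
    moreover have "(m div l + 2) * l \<le> n div l * l" using that by (rule mult_le_mono1)
    moreover have "n div l * l \<le> n" by simp
    moreover have "(m div l + 2) * l = m div l * l + 2 * l" by (simp only: distrib_right)
    ultimately show ?thesis by linarith
  qed
  show ?thesis
    using assms(2) *[of _ _] unfolding separated_def block_def by (metis (lifting) mem_Collect_eq)
qed

lemma separated_mono:
  "separated H I J \<Longrightarrow> I' \<subseteq> I \<Longrightarrow> J' \<subseteq> J \<Longrightarrow> separated H I' J'"
  unfolding separated_def by blast

lemma separated_sym: "separated H I J \<Longrightarrow> separated H J I"
  unfolding separated_def by blast

lemma diam_le_mono: "diam_le L I \<Longrightarrow> L \<le> L' \<Longrightarrow> diam_le L' I"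
  unfolding diam_le_def by (meson add_left_mono order_trans)

text \<open>The set need not start at a grid point, hence \<open>K + 1\<close> rather than
  \<open>K\<close>: the quotients run from that of the least element up to \<open>K\<close>
  more.\<close>

lemma card_blocks_le:
  assumes "diam_le (K * l) I" "l > 0"
  shows "card ((\<lambda>n. n div l) ` I) \<le> K + 1"
proof (cases "I = {}")
  case False
  define n0 where "n0 = (LEAST n. n \<in> I)"
  have n0: "n0 \<in> I" "\<And>n. n \<in> I \<Longrightarrow> n0 \<le> n"
    unfolding n0_def using False by (auto intro: LeastI Least_le)
  have "(\<lambda>n. n div l) ` I \<subseteq> {n0 div l .. n0 div l + K}"
  proof clarify
    fix n assume n: "n \<in> I"
    have "n \<le> n0 + K * l" using assms n n0 by (auto simp: diam_le_def)
    then have "n div l \<le> (n0 + K * l) div l" by (rule div_le_mono)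
    then show "n div l \<in> {n0 div l .. n0 div l + K}"
      using n0(2)[OF n] assms(2) div_le_mono by auto
  qed
  then have "card ((\<lambda>n. n div l) ` I) \<le> card {n0 div l .. n0 div l + K}" by (intro card_mono) auto
  then show ?thesis by auto
qed auto

lemma card_le_diam:
  assumes "diam_le L I" shows "card I \<le> L + 1"
  using card_blocks_le[of L 1 I] assms by simp

section \<open>Resonances of convex sequences\<close>

text \<open>The normalisation in which the sequence curves like a parabola with coefficients of size
  1. In the application it is about \<open>8 * N ^ 2\<close> times a uniformly convex
  sequence.\<close>

locale convex_sequence =
  fixes a :: "nat \<Rightarrow> real" and \<Lambda> :: nat
  assumes second_diff_ge: "1 \<le> a (i + 2) - 2 * a (i + 1) + a i"
    and second_diff_le: "a (i + 2) - 2 * a (i + 1) + a i \<le> real \<Lambda>"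
begin

definition slope :: "nat \<Rightarrow> real" where "slope i = a (i + 1) - a i"

lemma slope_add:
  "slope i + real k \<le> slope (i + k)" "slope (i + k) \<le> slope i + real \<Lambda> * real k"
proof (induction k)
  case (Suc k)
  { case 1
    show ?case using Suc second_diff_ge[of "i + k"] by (simp add: slope_def algebra_simps) }
  { case 2
    show ?case using Suc second_diff_le[of "i + k"] by (simp add: slope_def algebra_simps) }
qed auto

lemma slope_mono:
  assumes "i \<le> j"
  shows "slope i + real (j - i) \<le> slope j" "slope j \<le> slope i + real \<Lambda> * real (j - i)"
  using slope_add[of i "j - i"] assms by auto

lemma increment_le:
  assumes "\<And>i. m \<le> i \<Longrightarrow> i < n \<Longrightarrow> slope i \<le> s" "m \<le> n"
  shows "a n - a m \<le> s * real (n - m)"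
proof -
  have "a (m + k) - a m \<le> s * real k" if "k \<le> n - m" for k
    using that
  proof (induction k)
    case (Suc k)
    have "slope (m + k) \<le> s" using Suc.prems by (intro assms(1)) auto
    then show ?case using Suc by (simp add: slope_def algebra_simps)
  qed auto
  from this[of "n - m"] show ?thesis using assms(2) by auto
qed

lemma increment_ge:
  assumes "\<And>i. m \<le> i \<Longrightarrow> i < n \<Longrightarrow> s \<le> slope i" "m \<le> n"
  shows "s * real (n - m) \<le> a n - a m"
proof -
  have "s * real k \<le> a (m + k) - a m" if "k \<le> n - m" for k
    using that
  proof (induction k)
    case (Suc k)
    have "s \<le> slope (m + k)" using Suc.prems by (intro assms(1)) auto
    then show ?case using Suc by (simp add: slope_def algebra_simps)
  qed auto
  from this[of "n - m"] show ?thesis using assms(2) by auto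
qed

text \<open>The remainder over the tangent line at \<open>m0\<close>. Passing from \<open>a\<close>
  to the remainder leaves alternating sums unchanged when the indices themselves balance.\<close>

definition excess :: "nat \<Rightarrow> nat \<Rightarrow> real" where
  "excess m0 m = a m - a m0 - slope m0 * (real m - real m0)"

text \<open>Within distance \<open>L\<close> of \<open>m0\<close> the slope moves by at most
  \<open>\<Lambda> * L\<close>, always in the direction that keeps the remainder nonnegative, on
  both sides of \<open>m0\<close>.\<close>

lemma excess_bounds:
  assumes "m \<le> m0 + L" "m0 \<le> m + L"
  shows "0 \<le> excess m0 m" "excess m0 m \<le> real \<Lambda> * (real L)^2"
proof -
  have sq: "real \<Lambda> * real k * real k \<le> real \<Lambda> * (real L)^2" if "k \<le> L" for k
    using that by (auto simp: power2_eq_square mult.assoc intro!: mult_left_mono mult_mono)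
  have "0 \<le> excess m0 m \<and> excess m0 m \<le> real \<Lambda> * (real L)^2"
  proof (cases "m0 \<le> m")
    case True
    have s: "slope m0 \<le> slope i" "slope i \<le> slope m0 + real \<Lambda> * real (m - m0)"
      if "m0 \<le> i" "i < m" for i
    proof -
      show "slope m0 \<le> slope i" using slope_mono(1)[OF that(1)] by linarith
      have "real \<Lambda> * real (i - m0) \<le> real \<Lambda> * real (m - m0)"
        using that by (intro mult_left_mono) auto
      then show "slope i \<le> slope m0 + real \<Lambda> * real (m - m0)"
        using slope_mono(2)[OF that(1)] by linarith
    qed
    have "a m - a m0 \<le> (slope m0 + real \<Lambda> * real (m - m0)) * real (m - m0)"
      by (rule increment_le) (use s True in auto)
    moreover have "slope m0 * real (m - m0) \<le> a m - a m0"
      by (rule increment_ge) (use s True in auto)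
    moreover have "real \<Lambda> * real (m - m0) * real (m - m0) \<le> real \<Lambda> * (real L)^2"
      using assms by (intro sq) auto
    ultimately show ?thesis using True unfolding excess_def by (simp add: of_nat_diff algebra_simps)
  next
    case False
    have s: "slope i \<le> slope m0" "slope m0 - real \<Lambda> * real (m0 - m) \<le> slope i"
      if "m \<le> i" "i < m0" for i
    proof -
      have i: "i \<le> m0" using that by auto
      show "slope i \<le> slope m0" using slope_mono(1)[OF i] by linarith
      have "real \<Lambda> * real (m0 - i) \<le> real \<Lambda> * real (m0 - m)"
        using that by (intro mult_left_mono) auto
      then show "slope m0 - real \<Lambda> * real (m0 - m) \<le> slope i"
        using slope_mono(2)[OF i] by linarith
    qed
    have "a m0 - a m \<le> slope m0 * real (m0 - m)"
      by (rule increment_le) (use s False in auto)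
    moreover have "(slope m0 - real \<Lambda> * real (m0 - m)) * real (m0 - m) \<le> a m0 - a m"
      by (rule increment_ge) (use s False in auto)
    moreover have "real \<Lambda> * real (m0 - m) * real (m0 - m) \<le> real \<Lambda> * (real L)^2"
      using assms by (intro sq) auto
    ultimately show ?thesis using False unfolding excess_def by (simp add: of_nat_diff algebra_simps)
  qed
  then show "0 \<le> excess m0 m" "excess m0 m \<le> real \<Lambda> * (real L)^2" by auto
qed

text \<open>At distance \<open>H\<close> from \<open>m0\<close> the slope differs from the tangent
  slope by at least \<open>H\<close>, with one sign on each side, so the increments of the remainder
  cannot cancel.\<close>

lemma excess_diff_ge_aux:
  assumes "(m0 + H \<le> n' \<and> m0 + H \<le> n) \<or> (n + H \<le> m0 \<and> n' + H \<le> m0)" "n' \<le> n"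
  shows "real H * (real n - real n') \<le> \<bar>excess m0 n - excess m0 n'\<bar>"
  using assms(1)
proof
  assume *: "m0 + H \<le> n' \<and> m0 + H \<le> n"
  have "(slope m0 + real H) * real (n - n') \<le> a n - a n'"
  proof (rule increment_ge)
    fix i assume "n' \<le> i" "i < n"
    then have "m0 \<le> i" "real (i - m0) \<ge> real H" using * by auto
    then show "slope m0 + real H \<le> slope i" using slope_mono(1)[of m0 i] by linarith
  qed fact
  then show ?thesis using assms(2) unfolding excess_def by (simp add: of_nat_diff algebra_simps)
next
  assume *: "n + H \<le> m0 \<and> n' + H \<le> m0"
  have "a n - a n' \<le> (slope m0 - real H) * real (n - n')"
  proof (rule increment_le)
    fix i assume "n' \<le> i" "i < n"
    then have "i \<le> m0" "real (m0 - i) \<ge> real H" using * by auto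
    then show "slope i \<le> slope m0 - real H" using slope_mono(1)[of i m0] by linarith
  qed fact
  then show ?thesis using assms(2) unfolding excess_def by (simp add: of_nat_diff algebra_simps)
qed

lemma excess_diff_ge:
  assumes "(m0 + H \<le> n' \<and> m0 + H \<le> n) \<or> (n + H \<le> m0 \<and> n' + H \<le> m0)"
  shows "real H * \<bar>real n - real n'\<bar> \<le> \<bar>excess m0 n - excess m0 n'\<bar>"
proof (cases "n' \<le> n")
  case True
  then show ?thesis using excess_diff_ge_aux[of m0 H n' n] assms by auto
next
  case False
  then show ?thesis using excess_diff_ge_aux[of m0 H n n'] assms by (auto simp: abs_minus_commute)
qed

text \<open>Subtract the tangent line at \<open>m1\<close>, which the exact relation between the
  indices permits. The four remainders in \<open>J\<close> lie between 0 and
  \<open>\<Lambda> * L ^ 2\<close> and enter with two signs each, so they contribute at most twice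
  that. The difference of the remainders at \<open>n\<close> and \<open>n'\<close> must then be
  small, although it grows at rate \<open>H\<close>.\<close>

lemma resonance_gap:
  assumes "separated H I J" "diam_le L J"
    "n \<in> I" "n' \<in> I" "m1 \<in> J" "m2 \<in> J" "m3 \<in> J" "m4 \<in> J"
    "n + m1 + m2 = n' + m3 + m4" "\<bar>a n + a m1 + a m2 - (a n' + a m3 + a m4)\<bar> < 1"
  shows "real H * \<bar>real n - real n'\<bar> \<le> 1 + 2 * real \<Lambda> * (real L)^2"
proof -
  have ex: "0 \<le> excess m1 m" "excess m1 m \<le> real \<Lambda> * (real L)^2" if "m \<in> J" for m
    using excess_bounds[of m m1 L] assms(2,5) that by (auto simp: diam_le_def)
  have "real n + real m1 + real m2 = real n' + real m3 + real m4"
    using assms(9) by (metis of_nat_add)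
  then have r: "real n = real n' + real m3 + real m4 - real m1 - real m2" by linarith
  have "excess m1 n - excess m1 n' + excess m1 m1 + excess m1 m2 - excess m1 m3 - excess m1 m4
     = a n + a m1 + a m2 - (a n' + a m3 + a m4)"
    unfolding excess_def r by (simp add: algebra_simps)
  then have "\<bar>excess m1 n - excess m1 n'\<bar> \<le> 1 + 2 * real \<Lambda> * (real L)^2"
    using assms(10) ex[OF assms(5)] ex[OF assms(6)] ex[OF assms(7)] ex[OF assms(8)] by linarith
  moreover have "real H * \<bar>real n - real n'\<bar> \<le> \<bar>excess m1 n - excess m1 n'\<bar>"
    using assms(1,3,4,5) by (intro excess_diff_ge) (auto simp: separated_def)
  ultimately show ?thesis by linarith
qed

end

section \<open>Bilinear decoupling\<close>

text \<open>A finite model of averaging over space and time. All that is asked of the average is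
  that correlations of three functions against three vanish exactly, unless the indices balance and
  the values of \<open>a\<close> balance with error less than 1.\<close>

locale exponential_system = convex_sequence a \<Lambda>
  for a :: "nat \<Rightarrow> real" and \<Lambda> :: nat +
  fixes Z :: "'z set" and w :: "'z \<Rightarrow> real" and \<phi> :: "nat \<Rightarrow> 'z \<Rightarrow> complex" and N :: nat
  assumes finite_Z: "finite Z"
    and weight_nonneg: "z \<in> Z \<Longrightarrow> 0 \<le> w z"
    and weight_sum: "sum w Z \<le> 1"
    and unimodular: "cmod (\<phi> n z) = 1"
    and orthogonal: "\<lbrakk>n1 < N; n2 < N; n3 < N; m1 < N; m2 < N; m3 < N;
        n1 + n2 + n3 \<noteq> m1 + m2 + m3 \<or> 1 \<le> \<bar>a n1 + a n2 + a n3 - (a m1 + a m2 + a m3)\<bar>\<rbrakk>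
      \<Longrightarrow> (\<Sum>z\<in>Z. of_real (w z) * (\<phi> n1 z * \<phi> n2 z * \<phi> n3 z * cnj (\<phi> m1 z * \<phi> m2 z * \<phi> m3 z))) = 0"
begin

definition F :: "(nat \<Rightarrow> complex) \<Rightarrow> nat set \<Rightarrow> 'z \<Rightarrow> complex" where
  "F b I z = (\<Sum>n\<in>I. b n * \<phi> n z)"

definition mean :: "('z \<Rightarrow> real) \<Rightarrow> real" where
  "mean g = (\<Sum>z\<in>Z. w z * g z)"

definition cmean :: "('z \<Rightarrow> complex) \<Rightarrow> complex" where
  "cmean g = (\<Sum>z\<in>Z. of_real (w z) * g z)"

definition mass :: "(nat \<Rightarrow> complex) \<Rightarrow> nat set \<Rightarrow> real" where
  "mass b I = (\<Sum>n\<in>I. (cmod (b n))\<^sup>2)"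

lemma mean_mono: "(\<And>z. z \<in> Z \<Longrightarrow> f z \<le> g z) \<Longrightarrow> mean f \<le> mean g"
  unfolding mean_def by (intro sum_mono mult_left_mono weight_nonneg)

lemma mean_nonneg: "(\<And>z. z \<in> Z \<Longrightarrow> 0 \<le> g z) \<Longrightarrow> 0 \<le> mean g"
  unfolding mean_def by (intro sum_nonneg mult_nonneg_nonneg weight_nonneg)

lemma mean_add: "mean (\<lambda>z. f z + g z) = mean f + mean g"
  unfolding mean_def by (simp add: sum.distrib algebra_simps)

lemma mean_cmult: "mean (\<lambda>z. c * f z) = c * mean f"
  unfolding mean_def by (simp add: sum_distrib_left algebra_simps)

lemma mean_sum: "mean (\<lambda>z. \<Sum>i\<in>S. f i z) = (\<Sum>i\<in>S. mean (f i))"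
  unfolding mean_def by (simp add: sum_distrib_left sum.swap[of _ S])

lemma mean_const_le: "0 \<le> c \<Longrightarrow> mean (\<lambda>z. c) \<le> c"
  unfolding mean_def sum_distrib_right[symmetric] using weight_sum
  by (simp add: mult_left_le_one_le sum_nonneg weight_nonneg)

lemma cmean_sum: "cmean (\<lambda>z. \<Sum>i\<in>S. f i z) = (\<Sum>i\<in>S. cmean (f i))"
  unfolding cmean_def by (simp add: sum_distrib_left sum.swap[of _ S])

lemma cmean_cmult: "cmean (\<lambda>z. c * f z) = c * cmean f"
  unfolding cmean_def by (simp add: sum_distrib_left algebra_simps)

lemma cmean_of_real: "cmean (\<lambda>z. of_real (f z)) = of_real (mean f)"
  unfolding cmean_def mean_def by simp

lemma norm_cmean_le: "cmod (cmean f) \<le> mean (\<lambda>z. cmod (f z))"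
  unfolding cmean_def mean_def
  by (rule order_trans[OF norm_sum]) (auto intro!: sum_mono simp: norm_mult weight_nonneg)

lemma mean_Cauchy_Schwarz:
  assumes "\<And>z. z \<in> Z \<Longrightarrow> 0 \<le> f z" "\<And>z. z \<in> Z \<Longrightarrow> 0 \<le> g z"
  shows "mean (\<lambda>z. f z * g z) \<le> sqrt (mean (\<lambda>z. f z ^ 2)) * sqrt (mean (\<lambda>z. g z ^ 2))"
proof -
  have "(\<Sum>z\<in>Z. (sqrt (w z) * f z) * (sqrt (w z) * g z))\<^sup>2
      \<le> (\<Sum>z\<in>Z. (sqrt (w z) * f z)\<^sup>2) * (\<Sum>z\<in>Z. (sqrt (w z) * g z)\<^sup>2)"
    by (rule Cauchy_Schwarz_ineq_sum)
  moreover have "(sqrt (w z) * f z) * (sqrt (w z) * g z) = w z * (f z * g z)" if "z \<in> Z" for z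
  proof -
    have "(sqrt (w z) * f z) * (sqrt (w z) * g z) = (sqrt (w z) * sqrt (w z)) * (f z * g z)"
      by (simp only: ac_simps)
    then show ?thesis using weight_nonneg[OF that] by simp
  qed
  moreover have "(sqrt (w z) * h z)\<^sup>2 = w z * (h z)\<^sup>2" if "z \<in> Z" for z and h :: "'z \<Rightarrow> real"
    using weight_nonneg[OF that] by (simp add: power_mult_distrib)
  ultimately have "(mean (\<lambda>z. f z * g z))\<^sup>2 \<le> mean (\<lambda>z. f z ^ 2) * mean (\<lambda>z. g z ^ 2)"
    unfolding mean_def by simp
  then show ?thesis unfolding real_sqrt_mult[symmetric] by (rule real_le_rsqrt)
qed

lemma mass_nonneg: "0 \<le> mass b I"
  unfolding mass_def by (intro sum_nonneg) auto

lemma cmean_F_eq_0: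
  assumes "\<And>n. n \<in> I \<Longrightarrow> cmean (\<lambda>z. \<phi> n z * g z) = 0"
  shows "cmean (\<lambda>z. F b I z * g z) = 0"
proof -
  have "cmean (\<lambda>z. F b I z * g z) = (\<Sum>n\<in>I. b n * cmean (\<lambda>z. \<phi> n z * g z))"
    unfolding F_def sum_distrib_right cmean_sum by (simp add: mult.assoc cmean_cmult)
  then show ?thesis using assms by simp
qed

lemma cmean_cnj_F_eq_0:
  assumes "\<And>n. n \<in> I \<Longrightarrow> cmean (\<lambda>z. cnj (\<phi> n z) * g z) = 0"
  shows "cmean (\<lambda>z. cnj (F b I z) * g z) = 0"
proof -
  have "cmean (\<lambda>z. cnj (F b I z) * g z) = (\<Sum>n\<in>I. cnj (b n) * cmean (\<lambda>z. cnj (\<phi> n z) * g z))"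
    unfolding F_def cnj_sum sum_distrib_right cmean_sum by (simp add: mult.assoc cmean_cmult)
  then show ?thesis using assms by simp
qed

text \<open>Multilinear expansion, one factor at a time. The products are nested to the right so
  that the factor to be expanded always stands in front and the exponentials already chosen gather
  at the end.\<close>

lemma cmean_sextic_eq_0:
  assumes sub: "I \<subseteq> {..<N}" "I' \<subseteq> {..<N}" "J \<subseteq> {..<N}"
    and "\<And>n n' m1 m2 m3 m4. \<lbrakk>n \<in> I; n' \<in> I'; m1 \<in> J; m2 \<in> J; m3 \<in> J; m4 \<in> J\<rbrakk> \<Longrightarrow>
      n + m1 + m2 \<noteq> n' + m3 + m4 \<or> 1 \<le> \<bar>a n + a m1 + a m2 - (a n' + a m3 + a m4)\<bar>"
  shows "cmean (\<lambda>z. F b I z * (cnj (F b I' z) *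
      (F b J z * (F b J z * (cnj (F b J z) * cnj (F b J z)))))) = 0"
proof (rule cmean_F_eq_0)
  fix n assume n: "n \<in> I"
  have "cmean (\<lambda>z. cnj (F b I' z) *
      (\<phi> n z * (F b J z * (F b J z * (cnj (F b J z) * cnj (F b J z)))))) = 0"
  proof (rule cmean_cnj_F_eq_0)
    fix n' assume n': "n' \<in> I'"
    have "cmean (\<lambda>z. F b J z * (F b J z * (cnj (F b J z) * (cnj (F b J z) *
         (\<phi> n z * cnj (\<phi> n' z)))))) = 0"
    proof (rule cmean_F_eq_0)
      fix m1 assume m1: "m1 \<in> J"
      have "cmean (\<lambda>z. F b J z * (cnj (F b J z) * (cnj (F b J z) *
         (\<phi> n z * cnj (\<phi> n' z) * \<phi> m1 z)))) = 0"
      proof (rule cmean_F_eq_0)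
        fix m2 assume m2: "m2 \<in> J"
        have "cmean (\<lambda>z. cnj (F b J z) * (cnj (F b J z) *
           (\<phi> n z * cnj (\<phi> n' z) * \<phi> m1 z * \<phi> m2 z))) = 0"
        proof (rule cmean_cnj_F_eq_0)
          fix m3 assume m3: "m3 \<in> J"
          have "cmean (\<lambda>z. cnj (F b J z) *
             (\<phi> n z * cnj (\<phi> n' z) * \<phi> m1 z * \<phi> m2 z * cnj (\<phi> m3 z))) = 0"
          proof (rule cmean_cnj_F_eq_0)
            fix m4 assume m4: "m4 \<in> J"
            have "cmean (\<lambda>z. \<phi> n z * \<phi> m1 z * \<phi> m2 z * cnj (\<phi> n' z * \<phi> m3 z * \<phi> m4 z)) = 0"
              unfolding cmean_def
              using sub n n' m1 m2 m3 m4 by (intro orthogonal assms(4)) auto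
            then show "cmean (\<lambda>z. cnj (\<phi> m4 z) *
                (\<phi> n z * cnj (\<phi> n' z) * \<phi> m1 z * \<phi> m2 z * cnj (\<phi> m3 z))) = 0"
              by (simp add: ac_simps)
          qed
          then show "cmean (\<lambda>z. cnj (\<phi> m3 z) * (cnj (F b J z) *
             (\<phi> n z * cnj (\<phi> n' z) * \<phi> m1 z * \<phi> m2 z))) = 0"
            by (simp add: ac_simps)
        qed
        then show "cmean (\<lambda>z. \<phi> m2 z * (cnj (F b J z) * (cnj (F b J z) *
           (\<phi> n z * cnj (\<phi> n' z) * \<phi> m1 z)))) = 0"
          by (simp add: ac_simps)
      qed
      then show "cmean (\<lambda>z. \<phi> m1 z * (F b J z * (cnj (F b J z) * (cnj (F b J z) *
         (\<phi> n z * cnj (\<phi> n' z)))))) = 0"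
        by (simp add: ac_simps)
    qed
    then show "cmean (\<lambda>z. cnj (\<phi> n' z) *
       (\<phi> n z * (F b J z * (F b J z * (cnj (F b J z) * cnj (F b J z)))))) = 0"
      by (simp add: ac_simps)
  qed
  then show "cmean (\<lambda>z. \<phi> n z * (cnj (F b I' z) *
      (F b J z * (F b J z * (cnj (F b J z) * cnj (F b J z)))))) = 0"
    by (simp add: ac_simps)
qed

lemma F_blocks:
  assumes "finite I"
  shows "F b I z = (\<Sum>j\<in>(\<lambda>n. n div l) ` I. F b (block l I j) z)"
  unfolding F_def block_def by (rule sum.image_gen[OF assms])

lemma mass_blocks:
  assumes "finite I"
  shows "mass b I = (\<Sum>j\<in>(\<lambda>n. n div l) ` I. mass b (block l I j))"
  unfolding mass_def block_def by (rule sum.image_gen[OF assms])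

text \<open>Expand the square of \<open>F b I z\<close> into pairs of blocks. By
  \<open>resonance_gap\<close> a resonant pair has \<open>n\<close> and \<open>n'\<close> within
  \<open>(1 + 2 * \<Lambda>) * l\<close>, as \<open>l\<close> is \<open>L ^ 2 / H\<close>; all pairs
  of more distant blocks vanish. For the others the arithmetic-geometric mean inequality suffices,
  since each block has at most \<open>4 * \<Lambda> + 3\<close> near ones.\<close>

lemma bilinear_localization:
  assumes sub: "I \<subseteq> {..<N}" "J \<subseteq> {..<N}"
    and sep: "separated H I J" and diam: "diam_le L J" and scale: "H * l = L\<^sup>2" "L > 0"
  shows "mean (\<lambda>z. (cmod (F b I z))\<^sup>2 * cmod (F b J z) ^ 4)
    \<le> real (4 * \<Lambda> + 3) *
      (\<Sum>j\<in>(\<lambda>n. n div l) ` I. mean (\<lambda>z. (cmod (F b (block l I j) z))\<^sup>2 * cmod (F b J z) ^ 4))"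
proof -
  define S where "S = (\<lambda>n. n div l) ` I"
  have finI: "finite I" using sub finite_subset by blast
  then have finS: "finite S" by (simp add: S_def)
  have pos: "H > 0" "l > 0" using scale by (auto intro: Nat.gr0I)
  define G where "G z = F b J z * (F b J z * (cnj (F b J z) * cnj (F b J z)))" for z
  have G: "G z = of_real (cmod (F b J z) ^ 4)" for z
  proof -
    have "G z = (F b J z * cnj (F b J z))\<^sup>2" by (simp add: G_def power2_eq_square ac_simps)
    then show ?thesis by (simp add: complex_norm_square[symmetric] flip: power_mult of_real_power)
  qed
  define f where "f j z = F b (block l I j) z" for j z
  \<comment> \<open>The positions inside the blocks add less than \<open>l\<close> to the gap
    \<open>(1 + 2 * \<Lambda>) * l\<close>, so resonant block indices differ by less than
    \<open>2 * \<Lambda> + 2\<close>.\<close>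
  define near where "near j = {i\<in>S. nat \<bar>int i - int j\<bar> \<le> 2 * \<Lambda> + 1}" for j
  have far0: "cmean (\<lambda>z. f j z * (cnj (f i z) * G z)) = 0" if "i \<in> S - near j" for i j
    unfolding f_def G_def
  proof (rule cmean_sextic_eq_0)
    show "block l I j \<subseteq> {..<N}" "block l I i \<subseteq> {..<N}" "J \<subseteq> {..<N}"
      using sub block_subset by blast+
    fix n n' m1 m2 m3 m4
    assume *: "n \<in> block l I j" "n' \<in> block l I i" "m1 \<in> J" "m2 \<in> J" "m3 \<in> J" "m4 \<in> J"
    show "n + m1 + m2 \<noteq> n' + m3 + m4 \<or> 1 \<le> \<bar>a n + a m1 + a m2 - (a n' + a m3 + a m4)\<bar>"
    proof (rule ccontr)
      assume "\<not> ?thesis"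
      then have "real H * \<bar>real n - real n'\<bar> \<le> 1 + 2 * real \<Lambda> * (real L)^2"
        using * sep diam block_subset by (intro resonance_gap[of H I J L n n' m1 m2 m3 m4]) auto
      also have "\<dots> \<le> (1 + 2 * real \<Lambda>) * (real L)^2"
        using scale(2) by (simp add: algebra_simps)
      also have "(real L)^2 = real H * real l" using scale(1) by (metis of_nat_mult of_nat_power)
      finally have "real H * \<bar>real n - real n'\<bar> \<le> real H * ((1 + 2 * real \<Lambda>) * real l)"
        by (simp add: algebra_simps)
      then have "\<bar>real n - real n'\<bar> \<le> (1 + 2 * real \<Lambda>) * real l" using pos by simp
      moreover have "\<bar>real n - real n'\<bar> = real_of_int \<bar>int n - int n'\<bar>" by simp
      moreover have "(1 + 2 * real \<Lambda>) * real l = real_of_int ((1 + 2 * int \<Lambda>) * int l)" by simp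
      ultimately have d: "\<bar>int n - int n'\<bar> \<le> (1 + 2 * int \<Lambda>) * int l" by linarith
      have "n div l = j" "n' div l = i" using * by (auto simp: block_def)
      then have e: "int n = int j * int l + int (n mod l)" "int n' = int i * int l + int (n' mod l)"
        by (metis div_mult_mod_eq of_nat_add of_nat_mult)+
      have m: "n mod l < l" "n' mod l < l" using pos by auto
      define p q r where "p = int i * int l" and "q = int j * int l" and "r = int \<Lambda> * int l"
      have "\<bar>int n - int n'\<bar> \<le> int l + 2 * r" using d by (simp add: r_def algebra_simps)
      then have "\<bar>p - q\<bar> < 2 * int l + 2 * r"
        using e[folded p_def q_def] m by linarith
      also have "\<dots> = (2 + 2 * int \<Lambda>) * int l" by (simp add: r_def algebra_simps)
      finally have "\<bar>int i * int l - int j * int l\<bar> < (2 + 2 * int \<Lambda>) * int l"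
        unfolding p_def q_def .
      then have "\<bar>int i - int j\<bar> * int l < (2 + 2 * int \<Lambda>) * int l"
        by (simp add: abs_mult flip: left_diff_distrib)
      then have "\<bar>int i - int j\<bar> < 2 + 2 * int \<Lambda>" using pos by simp
      moreover have "\<not> nat \<bar>int i - int j\<bar> \<le> 2 * \<Lambda> + 1" using that by (auto simp: near_def)
      ultimately show False by linarith
    qed
  qed
  define u where "u j = mean (\<lambda>z. (cmod (f j z))\<^sup>2 * cmod (F b J z) ^ 4)" for j
  have cross: "cmod (cmean (\<lambda>z. f j z * (cnj (f i z) * G z))) \<le> (u j + u i) / 2" for i j
  proof -
    have "cmod (cmean (\<lambda>z. f j z * (cnj (f i z) * G z)))
        \<le> mean (\<lambda>z. cmod (f j z * (cnj (f i z) * G z)))" by (rule norm_cmean_le)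
    also have "\<dots> \<le> mean (\<lambda>z. (1/2) * ((cmod (f j z))\<^sup>2 * cmod (F b J z) ^ 4
         + (cmod (f i z))\<^sup>2 * cmod (F b J z) ^ 4))"
    proof (rule mean_mono)
      fix z
      have "cmod (f j z) * cmod (f i z) \<le> (1/2) * ((cmod (f j z))\<^sup>2 + (cmod (f i z))\<^sup>2)"
        using sum_squares_bound[of "cmod (f j z)" "cmod (f i z)"] by simp
      then have "(cmod (f j z) * cmod (f i z)) * cmod (F b J z) ^ 4
           \<le> ((1/2) * ((cmod (f j z))\<^sup>2 + (cmod (f i z))\<^sup>2)) * cmod (F b J z) ^ 4"
        by (rule mult_right_mono) auto
      then show "cmod (f j z * (cnj (f i z) * G z)) \<le> (1/2) * ((cmod (f j z))\<^sup>2 * cmod (F b J z) ^ 4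
         + (cmod (f i z))\<^sup>2 * cmod (F b J z) ^ 4)"
        by (simp add: G norm_mult norm_power algebra_simps)
    qed
    also have "\<dots> = (1/2) * (u j + u i)" unfolding mean_cmult mean_add u_def ..
    finally show ?thesis by simp
  qed
  have u0: "u j \<ge> 0" for j unfolding u_def by (intro mean_nonneg) auto
  have FI: "F b I z = (\<Sum>j\<in>S. f j z)" for z
    unfolding S_def f_def by (rule F_blocks[OF finI])
  have card_near: "real (card (near j)) \<le> real (4 * \<Lambda> + 3)" for j
  proof -
    have "int ` near j \<subseteq> {int j - (2 * int \<Lambda> + 1) .. int j + (2 * int \<Lambda> + 1)}"
      unfolding near_def by auto
    then have "card (int ` near j) \<le> card {int j - (2 * int \<Lambda> + 1) .. int j + (2 * int \<Lambda> + 1)}"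
      by (intro card_mono) auto
    then show ?thesis by (simp add: card_image)
  qed
  have near_sym: "i \<in> near j \<longleftrightarrow> j \<in> near i" if "i \<in> S" "j \<in> S" for i j
    using that by (auto simp: near_def abs_minus_commute)
  have "mean (\<lambda>z. (cmod (F b I z))\<^sup>2 * cmod (F b J z) ^ 4)
      = Re (cmean (\<lambda>z. of_real ((cmod (F b I z))\<^sup>2 * cmod (F b J z) ^ 4)))"
    unfolding cmean_of_real by simp
  also have "(\<lambda>z. complex_of_real ((cmod (F b I z))\<^sup>2 * cmod (F b J z) ^ 4))
     = (\<lambda>z. \<Sum>j\<in>S. \<Sum>i\<in>S. f j z * (cnj (f i z) * G z))"
  proof
    fix z
    have "complex_of_real ((cmod (F b I z))\<^sup>2 * cmod (F b J z) ^ 4) = F b I z * cnj (F b I z) * G z"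
      by (simp only: G of_real_mult complex_norm_square)
    also have "\<dots> = (\<Sum>j\<in>S. \<Sum>i\<in>S. f j z * (cnj (f i z) * G z))"
      unfolding FI cnj_sum sum_product by (simp only: sum_distrib_right mult.assoc)
    finally show "complex_of_real ((cmod (F b I z))\<^sup>2 * cmod (F b J z) ^ 4)
      = (\<Sum>j\<in>S. \<Sum>i\<in>S. f j z * (cnj (f i z) * G z))" .
  qed
  also have "Re (cmean (\<lambda>z. \<Sum>j\<in>S. \<Sum>i\<in>S. f j z * (cnj (f i z) * G z)))
     = (\<Sum>j\<in>S. \<Sum>i\<in>S. Re (cmean (\<lambda>z. f j z * (cnj (f i z) * G z))))"
    by (simp add: cmean_sum)
  also have "\<dots> = (\<Sum>j\<in>S. \<Sum>i\<in>near j. Re (cmean (\<lambda>z. f j z * (cnj (f i z) * G z))))"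
    using finS far0 by (intro sum.cong refl sum.mono_neutral_right) (auto simp: near_def)
  also have "\<dots> \<le> (\<Sum>j\<in>S. \<Sum>i\<in>near j. (u j + u i) / 2)"
    using cross order_trans[OF complex_Re_le_cmod] by (intro sum_mono) blast
  also have "\<dots> = ((\<Sum>j\<in>S. \<Sum>i\<in>near j. u j) + (\<Sum>j\<in>S. \<Sum>i\<in>near j. u i)) / 2"
    by (simp add: sum.distrib add_divide_distrib sum_divide_distrib[symmetric])
  \<comment> \<open>Nearness is symmetric, so exchanging the order of summation makes both halves
    equal.\<close>
  also have "(\<Sum>j\<in>S. \<Sum>i\<in>near j. u i) = (\<Sum>j\<in>S. \<Sum>i\<in>near j. u j)"
  proof -
    have nr: "near j = {i. i \<in> S \<and> i \<in> near j}" for j by (auto simp: near_def)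
    have "(\<Sum>j\<in>S. \<Sum>i\<in>near j. u i) = (\<Sum>j\<in>S. \<Sum>i\<in>{i. i \<in> S \<and> i \<in> near j}. u i)" using nr by simp
    also have "\<dots> = (\<Sum>i\<in>S. \<Sum>j\<in>{j. j \<in> S \<and> i \<in> near j}. u i)"
      by (rule sum.swap_restrict[OF finS finS])
    also have "\<dots> = (\<Sum>i\<in>S. \<Sum>j\<in>near i. u i)"
      using near_sym by (intro sum.cong refl) (auto simp: near_def)
    finally show ?thesis .
  qed
  also have "((\<Sum>j\<in>S. \<Sum>i\<in>near j. u j) + (\<Sum>j\<in>S. \<Sum>i\<in>near j. u j)) / 2
      = (\<Sum>j\<in>S. real (card (near j)) * u j)" by simp
  also have "\<dots> \<le> (\<Sum>j\<in>S. real (4 * \<Lambda> + 3) * u j)"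
    using card_near u0 by (intro sum_mono mult_right_mono)
  also have "\<dots> = real (4 * \<Lambda> + 3) * (\<Sum>j\<in>S. u j)" by (rule sum_distrib_left[symmetric])
  finally show ?thesis unfolding S_def u_def f_def .
qed

end

section \<open>Induction on scales: from bilinear to linear sixth-moment bounds\<close>

lemma sum_power_le_power_sum:
  fixes f :: "'a \<Rightarrow> real"
  assumes "finite S" "\<And>i. i \<in> S \<Longrightarrow> 0 \<le> f i"
  shows "(\<Sum>i\<in>S. f i ^ Suc p) \<le> (\<Sum>i\<in>S. f i) ^ Suc p"
proof -
  have "(\<Sum>i\<in>S. f i ^ Suc p) \<le> (\<Sum>i\<in>S. f i * (\<Sum>i\<in>S. f i) ^ p)"
    using assms by (auto intro!: sum_mono mult_left_mono power_mono member_le_sum)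
  then show ?thesis by (simp add: sum_distrib_right)
qed

context exponential_system
begin

lemma norm_F_square_le:
  assumes "finite I"
  shows "(cmod (F b I z))\<^sup>2 \<le> real (card I) * mass b I"
proof -
  have "cmod (F b I z) \<le> (\<Sum>n\<in>I. cmod (b n))"
    unfolding F_def by (rule sum_norm_le) (simp add: norm_mult unimodular)
  then have "(cmod (F b I z))\<^sup>2 \<le> (\<Sum>n\<in>I. 1 * cmod (b n))\<^sup>2" by (intro power_mono) auto
  also have "\<dots> \<le> (\<Sum>n\<in>I. 1\<^sup>2) * (\<Sum>n\<in>I. (cmod (b n))\<^sup>2)" by (rule Cauchy_Schwarz_ineq_sum)
  finally show ?thesis by (simp add: mass_def)
qed

lemma F_eq_0_if_mass_0: "finite I \<Longrightarrow> mass b I = 0 \<Longrightarrow> F b I z = 0"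
  using norm_F_square_le[of I b z] by simp

text \<open>Cauchy--Schwarz at every point. It starts the induction, for sets whose size is bounded
  independently of the final scale.\<close>

lemma sixth_moment_trivial:
  assumes "finite I" "card I \<le> M"
  shows "mean (\<lambda>z. cmod (F b I z) ^ 6) \<le> real M ^ 3 * mass b I ^ 3"
proof -
  have "cmod (F b I z) ^ 6 \<le> (real M * mass b I) ^ 3" for z
  proof -
    have "cmod (F b I z) ^ 6 = ((cmod (F b I z))\<^sup>2) ^ 3" by (simp flip: power_mult)
    also have "\<dots> \<le> (real (card I) * mass b I) ^ 3"
      by (intro power_mono norm_F_square_le assms) auto
    also have "\<dots> \<le> (real M * mass b I) ^ 3"
      using assms by (intro power_mono mult_right_mono mult_nonneg_nonneg mass_nonneg) auto
    finally show ?thesis .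
  qed
  then have "mean (\<lambda>z. cmod (F b I z) ^ 6) \<le> mean (\<lambda>z. (real M * mass b I) ^ 3)"
    by (intro mean_mono)
  also have "\<dots> \<le> (real M * mass b I) ^ 3"
    by (intro mean_const_le) (auto intro!: zero_le_power mult_nonneg_nonneg mass_nonneg)
  finally show ?thesis by (simp add: power_mult_distrib)
qed

text \<open>A substitute for Hoelder's inequality: after division by the masses,
  \<open>x * y ^ 2 \<le> x ^ 3 + y ^ 3\<close> applies pointwise and costs only the factor 2.
  Vanishing masses are split off because of the division.\<close>

lemma bilinear_trivial:
  assumes "finite I" "finite J"
    and "mean (\<lambda>z. cmod (F b I z) ^ 6) \<le> D * mass b I ^ 3"
    and "mean (\<lambda>z. cmod (F b J z) ^ 6) \<le> D * mass b J ^ 3"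
  shows "mean (\<lambda>z. (cmod (F b I z))\<^sup>2 * cmod (F b J z) ^ 4) \<le> 2 * D * mass b I * (mass b J)\<^sup>2"
proof (cases "mass b I = 0 \<or> mass b J = 0")
  case True
  then have "(cmod (F b I z))\<^sup>2 * cmod (F b J z) ^ 4 = 0" for z
    using F_eq_0_if_mass_0 assms(1,2) by auto
  then have "mean (\<lambda>z. (cmod (F b I z))\<^sup>2 * cmod (F b J z) ^ 4) = 0"
    unfolding mean_def by (intro sum.neutral) simp
  then show ?thesis using True by auto
next
  case False
  define s t where "s = mass b I" and "t = mass b J"
  have st: "s > 0" "t > 0"
    using False mass_nonneg[of b I] mass_nonneg[of b J] by (auto simp: s_def t_def)
  have young: "x * y\<^sup>2 \<le> x ^ 3 + y ^ 3" if "x \<ge> 0" "y \<ge> 0" for x y :: real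
  proof (cases "x \<le> y")
    case True
    then have "x * y\<^sup>2 \<le> y * y\<^sup>2" by (intro mult_right_mono) auto
    then show ?thesis using zero_le_power[OF that(1), of 3]
      by (simp add: power3_eq_cube power2_eq_square mult.assoc)
  next
    case False
    then have "x * y\<^sup>2 \<le> x * x\<^sup>2" using that by (intro mult_left_mono power_mono) auto
    then show ?thesis using zero_le_power[OF that(2), of 3]
      by (simp add: power3_eq_cube power2_eq_square mult.assoc)
  qed
  have pt: "(cmod (F b I z))\<^sup>2 * cmod (F b J z) ^ 4 \<le> s * t\<^sup>2 / s ^ 3 * cmod (F b I z) ^ 6
       + s * t\<^sup>2 / t ^ 3 * cmod (F b J z) ^ 6" for z
  proof -
    have "(s * t\<^sup>2) * ((cmod (F b I z))\<^sup>2 / s * ((cmod (F b J z))\<^sup>2 / t)\<^sup>2)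
        \<le> (s * t\<^sup>2) * (((cmod (F b I z))\<^sup>2 / s) ^ 3 + ((cmod (F b J z))\<^sup>2 / t) ^ 3)"
      using st by (intro mult_left_mono young) auto
    also have "(s * t\<^sup>2) * ((cmod (F b I z))\<^sup>2 / s * ((cmod (F b J z))\<^sup>2 / t)\<^sup>2)
       = (cmod (F b I z))\<^sup>2 * cmod (F b J z) ^ 4"
      using st by (simp add: power_divide flip: power_mult)
    finally show ?thesis by (simp add: power_divide algebra_simps flip: power_mult)
  qed
  have "mean (\<lambda>z. (cmod (F b I z))\<^sup>2 * cmod (F b J z) ^ 4)
    \<le> mean (\<lambda>z. s * t\<^sup>2 / s ^ 3 * cmod (F b I z) ^ 6 + s * t\<^sup>2 / t ^ 3 * cmod (F b J z) ^ 6)"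
    by (intro mean_mono pt)
  also have "\<dots> = s * t\<^sup>2 / s ^ 3 * mean (\<lambda>z. cmod (F b I z) ^ 6)
      + s * t\<^sup>2 / t ^ 3 * mean (\<lambda>z. cmod (F b J z) ^ 6)"
    unfolding mean_add mean_cmult ..
  also have "\<dots> \<le> s * t\<^sup>2 / s ^ 3 * (D * s ^ 3) + s * t\<^sup>2 / t ^ 3 * (D * t ^ 3)"
    using assms(3,4) st unfolding s_def[symmetric] t_def[symmetric]
    by (intro add_mono mult_left_mono) auto
  also have "\<dots> = 2 * D * s * t\<^sup>2" using st by simp
  finally show ?thesis unfolding s_def t_def .
qed

text \<open>
  \<open>H = K ^ h\<close> is the separation, and \<open>u\<close> measures in powers of \<open>K\<close> how much shorter \<open>J\<close> is. One step of
  localization and Cauchy--Schwarz doubles \<open>u\<close>, halves the exponent of the bilinear mean, and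
  contributes the gain \<open>q powr (- u / 2)\<close> through the linear estimate for \<open>J\<close>; the constant
  \<open>(4 * \<Lambda> + 3)\<^sup>2\<close> is the fixed point of \<open>X \<mapsto> (4 * \<Lambda> + 3) * sqrt X\<close>.
\<close>

lemma bilinear_estimate:
  fixes q A :: real and K h :: nat
  assumes q: "q \<ge> 1" and A: "A \<ge> 0" and K: "K > 0"
    and linear: "\<And>s I. \<lbrakk>s \<le> h; I \<subseteq> {..<N}; diam_le (K ^ s) I\<rbrakk> \<Longrightarrow>
      mean (\<lambda>z. cmod (F b I z) ^ 6) \<le> A * q ^ s * mass b I ^ 3"
  shows "\<lbrakk>u * 2 ^ k \<le> h; I \<subseteq> {..<N}; J \<subseteq> {..<N}; separated (K ^ h) I J;
      diam_le (K ^ h) I; diam_le (K ^ (h - u)) J\<rbrakk> \<Longrightarrow>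
    mean (\<lambda>z. (cmod (F b I z))\<^sup>2 * cmod (F b J z) ^ 4)
      \<le> (real (4 * \<Lambda> + 3))\<^sup>2 * A * q powr (real h - real u * real k / 2) * mass b I * (mass b J)\<^sup>2"
proof (induction k arbitrary: u I J)
  case 0
  define c where "c = real (4 * \<Lambda> + 3)"
  have J: "diam_le (K ^ h) J" using 0 K by (auto elim!: diam_le_mono intro!: power_increasing)
  have fin: "finite I" "finite J" using 0 finite_subset by blast+
  have "mean (\<lambda>z. (cmod (F b I z))\<^sup>2 * cmod (F b J z) ^ 4)
      \<le> 2 * (A * q ^ h) * mass b I * (mass b J)\<^sup>2"
    using 0 J fin linear[of h] by (intro bilinear_trivial) auto
  also have "\<dots> \<le> c\<^sup>2 * (A * q ^ h) * mass b I * (mass b J)\<^sup>2"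
  proof -
    have "3 * 3 \<le> c * c" unfolding c_def by (intro mult_mono) auto
    then show ?thesis using q A
      by (intro mult_right_mono mult_nonneg_nonneg mass_nonneg) (auto simp: power2_eq_square)
  qed
  finally show ?case using q by (simp add: c_def powr_realpow mult.assoc)
next
  case (Suc k)
  define c where "c = real (4 * \<Lambda> + 3)"
  \<comment> \<open>With separation \<open>K ^ h\<close> and \<open>J\<close> of length
    \<open>K ^ (h - u)\<close>, this is the length to which \<open>bilinear_localization\<close>
    cuts \<open>I\<close>.\<close>
  define l where "l = K ^ (h - 2 * u)"
  define S where "S = (\<lambda>n. n div l) ` I"
  define e where "e = real h - real u * real (Suc k) / 2"
  have u2: "2 * u * 2 ^ k \<le> h" using Suc.prems by simp
  have "2 * u * 1 \<le> 2 * u * 2 ^ k" by (intro mult_left_mono) auto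
  with u2 have u2h: "2 * u \<le> h" by linarith
  have fin: "finite I" "finite J" using Suc.prems finite_subset by blast+
  have l: "l > 0" using K by (simp add: l_def)
  have scale: "K ^ h * l = (K ^ (h - u))\<^sup>2"
  proof -
    have "K ^ h * l = K ^ (h + (h - 2 * u))" by (simp add: l_def power_add)
    also have "h + (h - 2 * u) = (h - u) * 2" using u2h by simp
    finally show ?thesis by (simp add: power_mult)
  qed
  have J: "diam_le (K ^ h) J" using Suc.prems K by (auto elim!: diam_le_mono intro!: power_increasing)
  have each: "mean (\<lambda>z. (cmod (F b (block l I j) z))\<^sup>2 * cmod (F b J z) ^ 4)
      \<le> c * A * q powr e * mass b (block l I j) * (mass b J)\<^sup>2" for j
  proof -
    let ?f = "F b (block l I j)" and ?m = "mass b (block l I j)"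
    have bl: "block l I j \<subseteq> I" "block l I j \<subseteq> {..<N}" using block_subset Suc.prems by blast+
    \<comment> \<open>This splitting makes Cauchy--Schwarz return the bilinear mean with the roles
      exchanged, to which the induction hypothesis with \<open>2 * u\<close> applies, and the sixth
      moment of \<open>J\<close>, which is at the smaller scale \<open>h - u\<close>.\<close>
    have "mean (\<lambda>z. (cmod (?f z))\<^sup>2 * cmod (F b J z) ^ 4)
       = mean (\<lambda>z. (cmod (F b J z) * (cmod (?f z))\<^sup>2) * cmod (F b J z) ^ 3)"
      by (simp add: eval_nat_numeral ac_simps)
    also have "\<dots> \<le> sqrt (mean (\<lambda>z. (cmod (F b J z) * (cmod (?f z))\<^sup>2)\<^sup>2))
        * sqrt (mean (\<lambda>z. (cmod (F b J z) ^ 3)\<^sup>2))"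
      by (rule mean_Cauchy_Schwarz) auto
    also have "\<dots> = sqrt (mean (\<lambda>z. (cmod (F b J z))\<^sup>2 * cmod (?f z) ^ 4)
        * mean (\<lambda>z. cmod (F b J z) ^ 6))"
      by (simp add: power_mult_distrib real_sqrt_mult flip: power_mult)
    also have "\<dots> \<le> sqrt ((c\<^sup>2 * A * q powr (real h - real (2 * u) * real k / 2) * mass b J * ?m\<^sup>2)
        * (A * q ^ (h - u) * mass b J ^ 3))"
    proof (intro real_sqrt_le_mono mult_mono)
      show "mean (\<lambda>z. (cmod (F b J z))\<^sup>2 * cmod (?f z) ^ 4)
         \<le> c\<^sup>2 * A * q powr (real h - real (2 * u) * real k / 2) * mass b J * ?m\<^sup>2"
        unfolding c_def
      proof (rule Suc.IH[OF u2])
        show "separated (K ^ h) J (block l I j)"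
          using Suc.prems(4) bl separated_mono separated_sym by blast
        show "diam_le (K ^ (h - 2 * u)) (block l I j)"
          using diam_le_block[OF l] by (simp add: l_def)
      qed (use Suc.prems bl J in auto)
      show "mean (\<lambda>z. cmod (F b J z) ^ 6) \<le> A * q ^ (h - u) * mass b J ^ 3"
        using Suc.prems by (intro linear) auto
    qed (use A q in \<open>auto intro!: mean_nonneg mult_nonneg_nonneg mass_nonneg\<close>)
    also have "\<dots> = sqrt ((c * A * q powr e * ?m * (mass b J)\<^sup>2)\<^sup>2)"
    proof -
      \<comment> \<open>The exponents \<open>h - u * k\<close> from the induction hypothesis and
        \<open>h - u\<close> from the linear estimate add up to \<open>2 * e\<close>.\<close>
      have "q powr (real h - real (2 * u) * real k / 2) * q ^ (h - u) = (q powr e)\<^sup>2"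
      proof -
        have "q ^ (h - u) = q powr (real h - real u)"
          using q u2h by (simp flip: powr_realpow)
        moreover have "(q powr e)\<^sup>2 = q powr (2 * e)" by (simp add: power2_eq_square flip: powr_add)
        moreover have "real h - real (2 * u) * real k / 2 + (real h - real u) = 2 * e"
          by (simp add: e_def field_simps)
        ultimately show ?thesis by (simp flip: powr_add)
      qed
      then have "c\<^sup>2 * A * A * (q powr (real h - real (2 * u) * real k / 2) * q ^ (h - u))
            * (mass b J * mass b J ^ 3) * ?m\<^sup>2
          = c\<^sup>2 * A * A * (q powr e)\<^sup>2 * (mass b J * mass b J ^ 3) * ?m\<^sup>2"
        by simp
      then show ?thesis by (simp add: eval_nat_numeral ac_simps)
    qed
    also have "\<dots> = c * A * q powr e * ?m * (mass b J)\<^sup>2"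
    proof -
      have "0 \<le> c * A * q powr e * ?m * (mass b J)\<^sup>2"
        using A by (intro mult_nonneg_nonneg mass_nonneg) (auto simp: c_def)
      then show ?thesis by (simp only: real_sqrt_abs abs_of_nonneg)
    qed
    finally show ?thesis .
  qed
  have "mean (\<lambda>z. (cmod (F b I z))\<^sup>2 * cmod (F b J z) ^ 4)
      \<le> c * (\<Sum>j\<in>S. mean (\<lambda>z. (cmod (F b (block l I j) z))\<^sup>2 * cmod (F b J z) ^ 4))"
    unfolding c_def S_def
    using Suc.prems scale K by (intro bilinear_localization[of I J "K ^ h" "K ^ (h - u)"]) auto
  also have "\<dots> \<le> c * (\<Sum>j\<in>S. c * A * q powr e * mass b (block l I j) * (mass b J)\<^sup>2)"
    by (intro mult_left_mono sum_mono each) (simp add: c_def)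
  also have "\<dots> = c\<^sup>2 * A * q powr e * mass b I * (mass b J)\<^sup>2"
    unfolding mass_blocks[OF fin(1), of b l, folded S_def]
    by (simp add: sum_distrib_left sum_distrib_right power2_eq_square ac_simps)
  finally show ?case unfolding c_def e_def .
qed

text \<open>Induction on the scale. Up to \<open>K ^ (2 ^ k)\<close> the trivial bound fits into
  \<open>A\<close>. Beyond it, \<open>broad_narrow\<close> is applied to blocks of length
  \<open>K ^ (r - 1)\<close>: the narrow part loses \<open>4 ^ 6\<close>, at most half of
  \<open>q\<close>, and in the broad part the loss \<open>(K + 1) ^ 12\<close> is paid for by the
  gain \<open>q powr (- k / 2)\<close> from \<open>bilinear_estimate\<close> with
  \<open>u = 1\<close>, which is available as \<open>2 ^ k \<le> r - 1\<close>.\<close>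

lemma sixth_moment_power:
  fixes q :: real and K k :: nat
  assumes K: "K \<ge> 1" and q: "2 * 4 ^ 6 \<le> q"
    and qk: "2 * (real K + 1) ^ 12 * (real (4 * \<Lambda> + 3))\<^sup>2 \<le> q powr (real k / 2)"
  defines "A \<equiv> real (K ^ (2 ^ k) + 1) ^ 3"
  shows "\<lbrakk>I \<subseteq> {..<N}; diam_le (K ^ r) I\<rbrakk> \<Longrightarrow>
    mean (\<lambda>z. cmod (F b I z) ^ 6) \<le> A * q ^ r * mass b I ^ 3"
proof (induction r arbitrary: I rule: less_induct)
  case (less r)
  have q1: "q \<ge> 1" using q by simp
  have A0: "A \<ge> 0" unfolding A_def by simp
  have finI: "finite I" using less.prems finite_subset by blast
  show ?case
  proof (cases "r \<le> 2 ^ k")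
    case True
    have "card I \<le> K ^ r + 1" by (rule card_le_diam[OF less.prems(2)])
    also have "\<dots> \<le> K ^ (2 ^ k) + 1" using True K by (intro add_right_mono power_increasing) auto
    finally have "mean (\<lambda>z. cmod (F b I z) ^ 6) \<le> A * mass b I ^ 3"
      unfolding A_def by (rule sixth_moment_trivial[OF finI])
    also have "\<dots> \<le> A * q ^ r * mass b I ^ 3"
      using q1 A0 mult_left_mono[of 1 "q ^ r" A]
      by (intro mult_right_mono zero_le_power mass_nonneg) auto
    finally show ?thesis .
  next
    case False
    define h where "h = r - 1"
    have r: "r = Suc h" "2 ^ k \<le> h" using False by (auto simp: h_def)
    have "(0::nat) < 2 ^ k" by simp
    with r have h1: "h \<ge> 1" by linarith
    define l where "l = K ^ h"
    have l: "l > 0" using K by (simp add: l_def)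
    define S where "S = (\<lambda>n. n div l) ` I"
    define B where "B j = block l I j" for j
    define m where "m j = mass b (B j)" for j
    define c where "c = real (4 * \<Lambda> + 3)"
    define E where "E = c\<^sup>2 * A * q powr (real h - real k / 2)"
    have E0: "E \<ge> 0" unfolding E_def using A0 by simp
    have finS: "finite S" using finI by (simp add: S_def)
    have BI: "B j \<subseteq> I" for j unfolding B_def by (rule block_subset)
    then have BN: "B j \<subseteq> {..<N}" for j using less.prems by blast
    have finB: "finite (B j)" for j using BI finI finite_subset by blast
    have dB: "diam_le (K ^ h) (B j)" for j
      using diam_le_block[OF l] unfolding B_def by (simp add: l_def)
    have cardS: "card S \<le> K + 1"
      unfolding S_def using less.prems(2) l by (intro card_blocks_le) (simp_all add: l_def r)
    have linear: "mean (\<lambda>z. cmod (F b J z) ^ 6) \<le> A * q ^ s * mass b J ^ 3"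
      if "s \<le> h" "J \<subseteq> {..<N}" "diam_le (K ^ s) J" for s J
      using less.IH[of s J] that r by auto
    have m0: "m j \<ge> 0" for j unfolding m_def by (rule mass_nonneg)
    have massI: "mass b I = (\<Sum>j\<in>S. m j)"
      unfolding m_def B_def S_def by (rule mass_blocks[OF finI])
    have FI: "F b I z = (\<Sum>j\<in>S. F b (B j) z)" for z
      unfolding B_def S_def by (rule F_blocks[OF finI])
    have far: "mean (\<lambda>z. (cmod (F b (B i) z))\<^sup>2 * cmod (F b (B j) z) ^ 4)
        \<le> (real K + 1) ^ 4 * E * m i * (m j)\<^sup>2" if "i + 2 \<le> j \<or> j + 2 \<le> i" for i j
    proof -
      \<comment> \<open>The bilinear gain requires a second block that is shorter than the
        separation by a factor \<open>K\<close>; cutting it into at most \<open>K + 1\<close> pieces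
        costs \<open>(K + 1) ^ 4\<close>.\<close>
      define l' where "l' = K ^ (h - 1)"
      have l': "l' > 0" using K by (simp add: l'_def)
      define T where "T = (\<lambda>n. n div l') ` B j"
      define B' where "B' n = block l' (B j) n" for n
      have finT: "finite T" using finB by (simp add: T_def)
      have B': "B' n \<subseteq> B j" for n unfolding B'_def by (rule block_subset)
      have "K * l' = K ^ h" using h1 by (simp add: l'_def flip: power_Suc)
      then have cardT: "card T \<le> K + 1"
        unfolding T_def using dB[of j] l' by (intro card_blocks_le) auto
      have pt: "cmod (F b (B j) z) ^ 4 \<le> (real K + 1) ^ 4 * (\<Sum>n\<in>T. cmod (F b (B' n) z) ^ 4)" for z
      proof -
        have "cmod (F b (B j) z) \<le> (\<Sum>n\<in>T. cmod (F b (B' n) z))"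
          unfolding F_blocks[OF finB, of b j z l'] T_def B'_def by (rule norm_sum)
        then have "cmod (F b (B j) z) ^ 4 \<le> (\<Sum>n\<in>T. cmod (F b (B' n) z)) ^ 4"
          by (intro power_mono) auto
        also have "\<dots> \<le> real (K + 1) ^ 4 * (\<Sum>n\<in>T. cmod (F b (B' n) z) ^ 4)"
          using finT cardT by (intro sum_pow_le_card_pow) auto
        finally show ?thesis by (simp add: add.commute)
      qed
      have "mean (\<lambda>z. (cmod (F b (B i) z))\<^sup>2 * cmod (F b (B j) z) ^ 4)
         \<le> mean (\<lambda>z. (cmod (F b (B i) z))\<^sup>2 * ((real K + 1) ^ 4 * (\<Sum>n\<in>T. cmod (F b (B' n) z) ^ 4)))"
        by (intro mean_mono mult_left_mono pt) auto
      also have "\<dots> = (real K + 1) ^ 4 * (\<Sum>n\<in>T. mean (\<lambda>z. (cmod (F b (B i) z))\<^sup>2 * cmod (F b (B' n) z) ^ 4))"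
        by (simp add: sum_distrib_left mult.left_commute flip: mean_cmult mean_sum)
      also have "\<dots> \<le> (real K + 1) ^ 4 * (\<Sum>n\<in>T. E * m i * (mass b (B' n))\<^sup>2)"
      proof (intro mult_left_mono sum_mono)
        fix n
        have "mean (\<lambda>z. (cmod (F b (B i) z))\<^sup>2 * cmod (F b (B' n) z) ^ 4)
           \<le> (real (4 * \<Lambda> + 3))\<^sup>2 * A * q powr (real h - real 1 * real k / 2) * mass b (B i) * (mass b (B' n))\<^sup>2"
        proof (rule bilinear_estimate[OF q1 A0])
          show "separated (K ^ h) (B i) (B' n)"
            using separated_mono[OF separated_block[OF l that, of I I] order_refl B'[of n, unfolded B_def]]
            unfolding B_def l_def .
          show "diam_le (K ^ (h - 1)) (B' n)"
            using diam_le_block[OF l'] unfolding B'_def by (simp add: l'_def)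
          show "B' n \<subseteq> {..<N}" using B' BN by blast
        qed (use K linear r BN dB in auto)
        then show "mean (\<lambda>z. (cmod (F b (B i) z))\<^sup>2 * cmod (F b (B' n) z) ^ 4)
            \<le> E * m i * (mass b (B' n))\<^sup>2"
          by (simp add: E_def c_def m_def)
      qed auto
      also have "\<dots> = (real K + 1) ^ 4 * (E * m i * (\<Sum>n\<in>T. (mass b (B' n))\<^sup>2))"
        by (simp add: sum_distrib_left)
      also have "\<dots> \<le> (real K + 1) ^ 4 * (E * m i * (m j)\<^sup>2)"
      proof -
        have "(\<Sum>n\<in>T. (mass b (B' n))\<^sup>2) \<le> (\<Sum>n\<in>T. mass b (B' n))\<^sup>2"
          using sum_power_le_power_sum[of T "\<lambda>n. mass b (B' n)" 1] finT mass_nonneg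
          by (simp add: numeral_2_eq_2)
        also have "(\<Sum>n\<in>T. mass b (B' n)) = m j"
          unfolding m_def T_def B'_def by (rule mass_blocks[OF finB, symmetric])
        finally show ?thesis using E0 m0 by (intro mult_left_mono mult_nonneg_nonneg) auto
      qed
      finally show ?thesis by (simp add: mult.assoc)
    qed
    have "mean (\<lambda>z. cmod (F b I z) ^ 6) \<le> mean (\<lambda>z. 4 ^ 6 * (\<Sum>j\<in>S. cmod (F b (B j) z) ^ 6)
       + real (K + 1) ^ 8 * (\<Sum>j\<in>S. \<Sum>i\<in>{i\<in>S. i + 2 \<le> j \<or> j + 2 \<le> i}.
            (cmod (F b (B i) z))\<^sup>2 * cmod (F b (B j) z) ^ 4))"
      unfolding FI by (intro mean_mono broad_narrow finS cardS)
    also have "\<dots> = 4 ^ 6 * (\<Sum>j\<in>S. mean (\<lambda>z. cmod (F b (B j) z) ^ 6))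
       + real (K + 1) ^ 8 * (\<Sum>j\<in>S. \<Sum>i\<in>{i\<in>S. i + 2 \<le> j \<or> j + 2 \<le> i}.
            mean (\<lambda>z. (cmod (F b (B i) z))\<^sup>2 * cmod (F b (B j) z) ^ 4))"
      unfolding mean_add mean_cmult mean_sum ..
    also have "\<dots> \<le> 4 ^ 6 * (\<Sum>j\<in>S. A * q ^ h * m j ^ 3)
       + real (K + 1) ^ 8 * (\<Sum>j\<in>S. \<Sum>i\<in>{i\<in>S. i + 2 \<le> j \<or> j + 2 \<le> i}.
            (real K + 1) ^ 4 * E * m i * (m j)\<^sup>2)"
      using far linear[OF order_refl BN dB] unfolding m_def
      by (intro add_mono mult_left_mono sum_mono) auto
    also have "\<dots> \<le> 4 ^ 6 * (\<Sum>j\<in>S. A * q ^ h * m j ^ 3)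
       + real (K + 1) ^ 8 * (\<Sum>j\<in>S. \<Sum>i\<in>S. (real K + 1) ^ 4 * E * m i * (m j)\<^sup>2)"
      using finS E0 m0
      by (intro add_left_mono mult_left_mono sum_mono sum_mono2) auto
    also have "\<dots> = 4 ^ 6 * A * q ^ h * (\<Sum>j\<in>S. m j ^ 3)
       + (real K + 1) ^ 12 * E * mass b I * (\<Sum>j\<in>S. (m j)\<^sup>2)"
    proof -
      have "(\<Sum>j\<in>S. \<Sum>i\<in>S. (real K + 1) ^ 4 * E * m i * (m j)\<^sup>2)
          = (real K + 1) ^ 4 * E * mass b I * (\<Sum>j\<in>S. (m j)\<^sup>2)"
      proof -
        have "(\<Sum>i\<in>S. (real K + 1) ^ 4 * E * m i * (m j)\<^sup>2)
            = (real K + 1) ^ 4 * E * mass b I * (m j)\<^sup>2" for j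
          unfolding massI by (simp only: sum_distrib_left sum_distrib_right)
        then show ?thesis by (simp only: sum_distrib_left)
      qed
      moreover have "real (K + 1) ^ 8 * ((real K + 1) ^ 4 * X) = (real K + 1) ^ 12 * X" for X
      proof -
        have "real (K + 1) = real K + 1" by simp
        moreover have "p ^ 8 * (p ^ 4 * X) = p ^ 12 * X" for p :: real
          by (simp flip: mult.assoc power_add)
        ultimately show ?thesis by metis
      qed
      ultimately show ?thesis by (simp only: mult.assoc sum_distrib_left[symmetric])
    qed
    also have "\<dots> \<le> 4 ^ 6 * A * q ^ h * mass b I ^ 3 + (real K + 1) ^ 12 * E * mass b I * (mass b I)\<^sup>2"
    proof (intro add_mono mult_left_mono)
      show "(\<Sum>j\<in>S. m j ^ 3) \<le> mass b I ^ 3"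
        using sum_power_le_power_sum[of S m 2] finS m0 unfolding massI by (simp add: numeral_3_eq_3 numeral_2_eq_2)
      show "(\<Sum>j\<in>S. (m j)\<^sup>2) \<le> (mass b I)\<^sup>2"
        using sum_power_le_power_sum[of S m 1] finS m0 unfolding massI by (simp add: numeral_2_eq_2)
    qed (use A0 q1 E0 mass_nonneg in auto)
    also have "\<dots> = (4 ^ 6 * A * q ^ h + (real K + 1) ^ 12 * E) * mass b I ^ 3"
      by (simp add: algebra_simps power3_eq_cube power2_eq_square)
    also have "\<dots> \<le> A * q ^ r * mass b I ^ 3"
    proof (intro mult_right_mono zero_le_power mass_nonneg)
      have "2 * ((real K + 1) ^ 12 * E)
          = A * (2 * (real K + 1) ^ 12 * c\<^sup>2) * q powr (real h - real k / 2)"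
        by (simp add: E_def ac_simps)
      also have "\<dots> \<le> A * (q powr (real k / 2)) * q powr (real h - real k / 2)"
        using qk A0 by (intro mult_right_mono mult_left_mono) (auto simp: c_def)
      also have "\<dots> = A * q ^ h" using q1 by (simp add: mult.assoc powr_realpow flip: powr_add)
      finally have "2 * ((real K + 1) ^ 12 * E) \<le> A * q ^ h" .
      moreover have Aq: "A * q ^ h \<ge> 0" using A0 q1 by auto
      moreover have "2 * 4 ^ 6 * (A * q ^ h) \<le> q * (A * q ^ h)"
        using q Aq by (rule mult_right_mono)
      moreover have "q * (A * q ^ h) = A * q ^ r" by (simp add: r)
      ultimately show "4 ^ 6 * A * q ^ h + (real K + 1) ^ 12 * E \<le> A * q ^ r"
        by (simp add: mult.assoc)
    qed
    finally show ?thesis .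
  qed
qed

end

text \<open>The order of choices matters: \<open>K\<close> depends on \<open>\<epsilon>\<close>
  alone, so that \<open>q = K powr \<epsilon>\<close> beats the narrow loss; then \<open>k\<close>
  is taken large enough for the broad loss at this \<open>K\<close>. The constant is thus fixed
  before the system, \<open>N\<close> and the coefficients.\<close>

lemma sixth_moment_uniform:
  fixes \<epsilon> :: real and \<Lambda> :: nat
  assumes "\<epsilon> > 0"
  obtains C where "C > 0"
    "\<And>a (Z :: 'z set) w \<phi> N b. \<lbrakk>exponential_system a \<Lambda> Z w \<phi> N; N \<ge> 1\<rbrakk> \<Longrightarrow>
      (\<Sum>z\<in>Z. w z * cmod (\<Sum>n<N. b n * \<phi> n z) ^ 6)
        \<le> C * real N powr \<epsilon> * (\<Sum>n<N. (cmod (b n))\<^sup>2) ^ 3"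
proof -
  \<comment> \<open>Here 8192 is \<open>2 * 4 ^ 6\<close>. Adding 2 below ensures that the powers of
    \<open>K\<close> exceed every \<open>N\<close>.\<close>
  obtain K0 :: nat where K0: "8192 powr (1 / \<epsilon>) \<le> real K0" using real_arch_simple by blast
  define K where "K = K0 + 2"
  define q where "q = real K powr \<epsilon>"
  have "8192 = (8192 powr (1 / \<epsilon>)) powr \<epsilon>" using assms by (simp add: powr_powr)
  also have "\<dots> \<le> q" unfolding q_def K_def using assms K0 by (intro powr_mono2) auto
  finally have q: "2 * 4 ^ 6 \<le> q" by simp
  then have q1: "q > 1" by simp
  obtain k0 where k0: "2 * (real K + 1) ^ 12 * (real (4 * \<Lambda> + 3))\<^sup>2 < q ^ k0"
    using real_arch_pow[OF q1] by blast
  define k where "k = 2 * k0"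
  have qk: "2 * (real K + 1) ^ 12 * (real (4 * \<Lambda> + 3))\<^sup>2 \<le> q powr (real k / 2)"
    using k0 q1 by (simp add: k_def powr_realpow)
  define A where "A = real (K ^ (2 ^ k) + 1) ^ 3"
  have A: "A > 0" unfolding A_def by (intro zero_less_power) (simp add: add_pos_nonneg)
  show thesis
  proof (rule that[of "A * q"])
    show "A * q > 0" using A q1 by simp
  next
    fix a :: "nat \<Rightarrow> real" and Z :: "'z set" and w \<phi> N and b :: "nat \<Rightarrow> complex"
    assume ex: "exponential_system a \<Lambda> Z w \<phi> N" and N: "N \<ge> 1"
    interpret exponential_system a \<Lambda> Z w \<phi> N by fact
    \<comment> \<open>By minimality \<open>K ^ (r - 1)\<close> is at most \<open>N\<close> when
      \<open>r\<close> is positive, so \<open>q ^ r\<close> exceeds \<open>N powr \<epsilon>\<close>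
      by at most one factor \<open>q\<close>.\<close>
    define r where "r = (LEAST r. N \<le> K ^ r)"
    have K2: "K \<ge> 2" by (simp add: K_def)
    have "N \<le> K ^ N" using K2 by (meson less_imp_le_nat less_exp power_mono order_trans zero_le)
    then have Nr: "N \<le> K ^ r" unfolding r_def by (rule LeastI)
    have "mean (\<lambda>z. cmod (F b {..<N} z) ^ 6) \<le> A * q ^ r * mass b {..<N} ^ 3"
      unfolding A_def using K2 q qk Nr
      by (intro sixth_moment_power) (auto simp: diam_le_def)
    also have "\<dots> \<le> (A * q) * real N powr \<epsilon> * mass b {..<N} ^ 3"
    proof (intro mult_right_mono zero_le_power mass_nonneg)
      have "q ^ r \<le> q * real N powr \<epsilon>"
      proof (cases r)
        case 0
        then show ?thesis
          using N assms q1 mult_mono[of 1 q 1 "real N powr \<epsilon>"] by (simp add: ge_one_powr_ge_zero)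
      next
        case (Suc s)
        have "\<not> N \<le> K ^ s" using not_less_Least[of s "\<lambda>r. N \<le> K ^ r"] Suc unfolding r_def by auto
        then have "real (K ^ s) \<le> real N" by (intro of_nat_mono) simp
        then have "real K ^ s \<le> real N" by simp
        then have "(real K ^ s) powr \<epsilon> \<le> real N powr \<epsilon>" using assms by (intro powr_mono2) auto
        moreover have "(real K ^ s) powr \<epsilon> = q ^ s"
        proof -
          have "(real K ^ s) powr \<epsilon> = (real K powr real s) powr \<epsilon>" using K2 by (simp add: powr_realpow)
          also have "\<dots> = q powr real s" unfolding q_def by (simp add: powr_powr mult.commute)
          finally show ?thesis using q1 by (simp add: powr_realpow)
        qed
        ultimately show ?thesis using Suc q1 by simp
      qed
      then show "A * q ^ r \<le> A * q * real N powr \<epsilon>" using A by simp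
    qed
    finally show "(\<Sum>z\<in>Z. w z * cmod (\<Sum>n<N. b n * \<phi> n z) ^ 6)
        \<le> A * q * real N powr \<epsilon> * (\<Sum>n<N. (cmod (b n))\<^sup>2) ^ 3"
      unfolding mean_def F_def mass_def .
  qed
qed

section \<open>Exponential sums sampled on a grid\<close>

lemma e_eq_cis: "e x = cis (2 * pi * x)"
  by (simp add: e_def cis_conv_exp mult.commute)

lemma e_0 [simp]: "e 0 = 1"
  by (simp add: e_eq_cis)

lemma norm_e [simp]: "cmod (e x) = 1"
  by (simp add: e_eq_cis)

lemma e_add: "e (x + y) = e x * e y"
  by (simp add: e_eq_cis cis_mult distrib_left)

lemma cnj_e: "cnj (e x) = e (- x)"
  by (simp add: e_eq_cis cis_cnj)

lemma e_power: "e x ^ n = e (real n * x)"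
  by (induction n) (simp_all add: distrib_right flip: e_add)

lemma e_of_int: "e (of_int m) = 1"
  by (simp add: e_eq_cis cis_multiple_2pi)

lemma e_eq_1_iff: "e x = 1 \<longleftrightarrow> x \<in> \<int>"
proof
  assume "e x = 1"
  then have "cos (2 * pi * x) = 1" by (metis cis.sel(1) e_eq_cis one_complex.sel(1))
  then obtain m where "2 * pi * x = of_int m * 2 * pi" by (auto simp: cos_one_2pi_int)
  then have "x = of_int m" by simp
  then show "x \<in> \<int>" by simp
qed (auto elim!: Ints_cases simp: e_of_int)

lemma sum_e_root_of_unity:
  assumes "P > 0"
  shows "(\<Sum>y<P. e (real y * (of_int m / real P))) = (if int P dvd m then of_nat P else 0)"
proof -
  define u where "u = e (of_int m / real P)"
  have s: "(\<Sum>y<P. e (real y * (of_int m / real P))) = (\<Sum>y<P. u ^ y)"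
    by (simp add: u_def e_power)
  have uP: "u ^ P = 1" using assms by (simp add: u_def e_power e_of_int)
  have u1: "u = 1 \<longleftrightarrow> int P dvd m"
  proof
    assume "u = 1"
    then obtain k where "real_of_int m / real P = of_int k"
      unfolding u_def e_eq_1_iff by (auto elim: Ints_cases)
    then have "real_of_int m = real_of_int (k * int P)" using assms by (simp add: field_simps)
    then have "m = k * int P" by (simp only: of_int_eq_iff)
    then show "int P dvd m" by simp
  next
    assume "int P dvd m"
    then obtain k where "m = int P * k" by (auto elim: dvdE)
    then show "u = 1" using assms by (simp add: u_def e_of_int)
  qed
  show ?thesis
  proof (cases "u = 1")
    case True
    then show ?thesis using s u1 by simp
  next
    case False
    then show ?thesis using s u1 uP by (simp add: geometric_sum)
  qed
qed

text \<open>The discrete Fourier transform of the Fejer kernel: it counts pairs with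
  \<open>h - h'\<close> congruent to \<open>-d\<close> modulo \<open>Q\<close>, and therefore
  vanishes when \<open>d\<close> stays at distance at least \<open>M\<close> from the multiples of
  \<open>Q\<close>.\<close>

lemma sum_Fejer:
  assumes "Q > 0"
  shows "(\<Sum>j<Q. of_real ((cmod (\<Sum>h<M. e (real h * (real j / real Q))))\<^sup>2) * e (real j * (of_int d / real Q)))
    = (\<Sum>h<M. \<Sum>h'<M. if int Q dvd int h - int h' + d then of_nat Q else 0)"
proof -
  have "of_real ((cmod (\<Sum>h<M. e (real h * (real j / real Q))))\<^sup>2) * e (real j * (of_int d / real Q))
     = (\<Sum>h<M. \<Sum>h'<M. e (real j * (of_int (int h - int h' + d) / real Q)))" for j
  proof -
    have "of_real ((cmod (\<Sum>h<M. e (real h * (real j / real Q))))\<^sup>2) * e (real j * (of_int d / real Q))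
      = (\<Sum>h<M. \<Sum>h'<M. e (real h * (real j / real Q)) * e (- (real h' * (real j / real Q)))
          * e (real j * (of_int d / real Q)))"
      unfolding complex_norm_square cnj_sum sum_product cnj_e by (simp only: sum_distrib_right)
    also have "\<dots> = (\<Sum>h<M. \<Sum>h'<M. e (real j * (of_int (int h - int h' + d) / real Q)))"
      using assms by (intro sum.cong refl) (simp add: field_simps flip: e_add)
    finally show ?thesis .
  qed
  then have "(\<Sum>j<Q. of_real ((cmod (\<Sum>h<M. e (real h * (real j / real Q))))\<^sup>2) * e (real j * (of_int d / real Q)))
     = (\<Sum>j<Q. \<Sum>h<M. \<Sum>h'<M. e (real j * (of_int (int h - int h' + d) / real Q)))"
    by (simp only:)
  also have "\<dots> = (\<Sum>h<M. \<Sum>j<Q. \<Sum>h'<M. e (real j * (of_int (int h - int h' + d) / real Q)))"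
    by (rule sum.swap)
  also have "\<dots> = (\<Sum>h<M. \<Sum>h'<M. \<Sum>j<Q. e (real j * (of_int (int h - int h' + d) / real Q)))"
    by (intro sum.cong refl sum.swap)
  finally show ?thesis unfolding sum_e_root_of_unity[OF assms] .
qed

text \<open>The cube of the polynomial has degree less than \<open>3 * N\<close>, so Parseval on the
  \<open>3 * N\<close> roots of unity is exact for it. Cauchy--Schwarz on its \<open>3 * N\<close>
  coefficients loses precisely the factor that Parseval returns.\<close>

lemma trig_sixth_power_le:
  assumes "N \<ge> 1"
  shows "cmod (\<Sum>n<N. c n * e (real n * x)) ^ 6
    \<le> (\<Sum>y<3 * N. cmod (\<Sum>n<N. c n * e (real n * (real y / real (3 * N)))) ^ 6)"
proof -
  define P where "P = 3 * N"
  have P: "P > 0" using assms by (simp add: P_def)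
  define p where "p = (\<Sum>n<N. monom (c n) n)"
  define r where "r = p ^ 3"
  have "degree p \<le> N - 1" unfolding p_def
    by (intro degree_sum_le) (auto intro: order_trans[OF degree_monom_le])
  then have "degree r \<le> (N - 1) * 3" unfolding r_def
    by (intro order_trans[OF degree_power_le]) simp
  then have deg: "degree r < P" using assms by (simp add: P_def)
  have p: "poly p (e x) = (\<Sum>n<N. c n * e (real n * x))" for x
    by (simp add: p_def poly_sum poly_monom e_power)
  have r: "poly r (e x) = (\<Sum>k<P. coeff r k * e (real k * x))" for x
  proof -
    have "poly r (e x) = (\<Sum>k\<le>degree r. coeff r k * e x ^ k)" by (rule poly_altdef)
    also have "\<dots> = (\<Sum>k<P. coeff r k * e x ^ k)"
      using deg by (intro sum.mono_neutral_left) (auto simp: coeff_eq_0)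
    finally show ?thesis by (simp add: e_power)
  qed
  have six: "(cmod (poly r (e x)))\<^sup>2 = cmod (\<Sum>n<N. c n * e (real n * x)) ^ 6" for x
    by (simp add: r_def p norm_power flip: power_mult)
  have parseval: "(\<Sum>y<P. (cmod (poly r (e (real y / real P))))\<^sup>2) = real P * (\<Sum>k<P. (cmod (coeff r k))\<^sup>2)"
  proof -
    have "complex_of_real (\<Sum>y<P. (cmod (poly r (e (real y / real P))))\<^sup>2)
        = (\<Sum>y<P. \<Sum>k<P. \<Sum>k'<P. coeff r k * cnj (coeff r k') * e (real y * (of_int (int k - int k') / real P)))"
      unfolding of_real_sum
    proof (intro sum.cong refl)
      fix y
      have "complex_of_real ((cmod (poly r (e (real y / real P))))\<^sup>2)
        = (\<Sum>k<P. \<Sum>k'<P. (coeff r k * e (real k * (real y / real P))) * (cnj (coeff r k') * e (- (real k' * (real y / real P)))))"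
        unfolding complex_norm_square r cnj_sum complex_cnj_mult cnj_e by (rule sum_product)
      also have "\<dots> = (\<Sum>k<P. \<Sum>k'<P. coeff r k * cnj (coeff r k') * e (real y * (of_int (int k - int k') / real P)))"
      proof (intro sum.cong refl)
        fix k k'
        have "real y * (of_int (int k - int k') / real P)
           = real k * (real y / real P) + - (real k' * (real y / real P))"
          by (simp add: algebra_simps diff_divide_distrib)
        then show "(coeff r k * e (real k * (real y / real P))) * (cnj (coeff r k') * e (- (real k' * (real y / real P))))
           = coeff r k * cnj (coeff r k') * e (real y * (of_int (int k - int k') / real P))"
          by (simp only: e_add ac_simps)
      qed
      finally show "complex_of_real ((cmod (poly r (e (real y / real P))))\<^sup>2) = \<dots>" .
    qed
    also have "\<dots> = (\<Sum>k<P. \<Sum>y<P. \<Sum>k'<P. coeff r k * cnj (coeff r k') * e (real y * (of_int (int k - int k') / real P)))"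
      by (rule sum.swap)
    also have "\<dots> = (\<Sum>k<P. \<Sum>k'<P. \<Sum>y<P. coeff r k * cnj (coeff r k') * e (real y * (of_int (int k - int k') / real P)))"
      by (intro sum.cong refl sum.swap)
    also have "\<dots> = (\<Sum>k<P. \<Sum>k'<P. coeff r k * cnj (coeff r k') * (if k = k' then of_nat P else 0))"
    proof (intro sum.cong refl)
      fix k k' assume k: "k \<in> {..<P}" "k' \<in> {..<P}"
      have "int P dvd int k - int k' \<longleftrightarrow> k = k'"
      proof
        assume "int P dvd int k - int k'"
        moreover have "\<bar>int k - int k'\<bar> < int P" using k by auto
        ultimately have "int k - int k' = 0" using zdvd_not_zless[of "\<bar>int k - int k'\<bar>" "int P"]
          by (metis dvd_abs_iff zero_less_abs_iff)
        then show "k = k'" by simp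
      qed simp
      then show "(\<Sum>y<P. coeff r k * cnj (coeff r k') * e (real y * (of_int (int k - int k') / real P)))
         = coeff r k * cnj (coeff r k') * (if k = k' then of_nat P else 0)"
        unfolding sum_distrib_left[symmetric] sum_e_root_of_unity[OF P] by simp
    qed
    also have "\<dots> = (\<Sum>k<P. coeff r k * cnj (coeff r k) * of_nat P)"
      by (intro sum.cong refl) (simp add: if_distrib cong: if_cong)
    also have "\<dots> = complex_of_real (real P * (\<Sum>k<P. (cmod (coeff r k))\<^sup>2))"
      by (simp add: complex_norm_square sum_distrib_left mult.commute del: of_real_power)
    finally show ?thesis by (simp only: of_real_eq_iff)
  qed
  have "cmod (poly r (e x)) \<le> (\<Sum>k<P. cmod (coeff r k))"
    unfolding r by (rule sum_norm_le) (simp add: norm_mult)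
  then have "(cmod (poly r (e x)))\<^sup>2 \<le> (\<Sum>k<P. 1 * cmod (coeff r k))\<^sup>2" by (intro power_mono) auto
  also have "\<dots> \<le> (\<Sum>k<P. 1\<^sup>2) * (\<Sum>k<P. (cmod (coeff r k))\<^sup>2)" by (rule Cauchy_Schwarz_ineq_sum)
  also have "\<dots> = (\<Sum>y<P. (cmod (poly r (e (real y / real P))))\<^sup>2)" unfolding parseval by simp
  finally show ?thesis unfolding six P_def .
qed

text \<open>The locale bounds second differences at every index, whereas the data stop at
  \<open>N\<close>. The second differences are continued by \<open>lo\<close> and summed twice,
  starting from the first two values.\<close>

lemma extend_second_differences:
  fixes s :: "nat \<Rightarrow> int"
  assumes "\<And>n. n + 2 < N \<Longrightarrow> s (n + 2) - 2 * s (n + 1) + s n \<in> {lo..hi}" "lo \<le> hi"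
  shows "\<exists>A. (\<forall>n<N. A n = s n) \<and> (\<forall>n. A (n + 2) - 2 * A (n + 1) + A n \<in> {lo..hi})"
proof -
  define dd where "dd i = (if i + 2 < N then s (i + 2) - 2 * s (i + 1) + s i else lo)" for i
  define D where "D n = s 1 - s 0 + (\<Sum>i<n. dd i)" for n
  define A where "A n = s 0 + (\<Sum>i<n. D i)" for n
  have D: "D n = s (n + 1) - s n" if "n + 1 < N" for n
    using that by (induction n) (auto simp: D_def dd_def)
  have "A n = s n" if "n < N" for n
    using that
  proof (induction n)
    case (Suc n)
    then show ?case using D[of n] by (simp add: A_def)
  qed (simp add: A_def)
  moreover have "A (n + 2) - 2 * A (n + 1) + A n = dd n" for n
    by (simp add: A_def D_def)
  then have "A (n + 2) - 2 * A (n + 1) + A n \<in> {lo..hi}" for n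
    using assms by (simp add: dd_def)
  ultimately show ?thesis by blast
qed

text \<open>
  The Fejer weight in the second coordinate makes the sample points see frequencies only up to
  resolution \<open>M\<close>, and exactly so since its Fourier transform has compact support. The condition on
  \<open>Q\<close> excludes aliasing.
\<close>

lemma Fejer_exponential_system:
  fixes A :: "nat \<Rightarrow> int" and M P Q N :: nat and B :: int
  assumes pos: "M > 0" "P > 0" and P: "3 * N \<le> P" and Q: "3 * B + int M \<le> int Q"
    and sd: "\<And>n. A (n + 2) - 2 * A (n + 1) + A n \<in> {int M..int \<Lambda> * int M}"
    and B: "\<And>n m. n < N \<Longrightarrow> m < N \<Longrightarrow> \<bar>A n - A m\<bar> \<le> B" "B \<ge> 0"
  shows "exponential_system (\<lambda>n. of_int (A n) / real M) \<Lambda> ({..<P} \<times> {..<Q})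
     (\<lambda>z. (cmod (\<Sum>h<M. e (real h * (real (snd z) / real Q))))\<^sup>2 / (real P * real Q * real M))
     (\<lambda>n z. e (real n * (real (fst z) / real P) + of_int (A n) * (real (snd z) / real Q))) N"
    (is "exponential_system ?a \<Lambda> ?Z ?w ?\<phi> N")
proof -
  have Q0: "Q > 0" using Q B pos by linarith
  define D where "D j = (cmod (\<Sum>h<M. e (real h * (real j / real Q))))\<^sup>2" for j :: nat
  define N0 where "N0 = real P * real Q * real M"
  have N0: "N0 > 0" using pos Q0 by (simp add: N0_def)
  have w: "?w z = D (snd z) / N0" for z by (simp add: D_def N0_def)
  have sdr: "?a (i + 2) - 2 * ?a (i + 1) + ?a i = real_of_int (A (i + 2) - 2 * A (i + 1) + A i) / real M" for i
    by (simp add: diff_divide_distrib add_divide_distrib)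
  have s1: "1 \<le> ?a (i + 2) - 2 * ?a (i + 1) + ?a i" for i
  proof -
    have "real_of_int (int M) \<le> real_of_int (A (i + 2) - 2 * A (i + 1) + A i)"
      using sd[of i] by (simp only: of_int_le_iff) simp
    then show ?thesis unfolding sdr using pos by (simp add: le_divide_eq)
  qed
  have s2: "?a (i + 2) - 2 * ?a (i + 1) + ?a i \<le> real \<Lambda>" for i
  proof -
    have "real_of_int (A (i + 2) - 2 * A (i + 1) + A i) \<le> real_of_int (int \<Lambda> * int M)"
      using sd[of i] by (simp only: of_int_le_iff) simp
    then show ?thesis unfolding sdr using pos by (simp add: divide_le_eq)
  qed
  have wsum: "sum ?w ?Z \<le> 1"
  proof -
    have "complex_of_real (\<Sum>j<Q. D j)
        = (\<Sum>j<Q. of_real ((cmod (\<Sum>h<M. e (real h * (real j / real Q))))\<^sup>2) * e (real j * (of_int 0 / real Q)))"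
      by (simp add: D_def)
    also have "\<dots> = (\<Sum>h<M. \<Sum>h'<M. if int Q dvd int h - int h' + 0 then of_nat Q else 0)"
      by (rule sum_Fejer[OF Q0])
    \<comment> \<open>Since \<open>M\<close> is at most \<open>Q\<close>, only the diagonal
      survives, and the weights have total 1.\<close>
    also have "\<dots> = (\<Sum>h<M. \<Sum>h'<M. if h = h' then of_nat Q else 0)"
    proof (intro sum.cong refl if_cong)
      fix h h' assume "h \<in> {..<M}" "h' \<in> {..<M}"
      then have "\<bar>int h - int h'\<bar> < int Q" using Q B by auto
      then show "int Q dvd int h - int h' + 0 \<longleftrightarrow> h = h'"
        using dvd_imp_le_int[of "int h - int h'" "int Q"] by fastforce
    qed
    also have "\<dots> = of_real (real M * real Q)" by simp
    finally have s: "(\<Sum>j<Q. D j) = real M * real Q" by (simp only: of_real_eq_iff)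
    have "sum ?w ?Z = (\<Sum>y<P. \<Sum>j<Q. D j / N0)"
      unfolding sum.cartesian_product w by (simp add: case_prod_unfold)
    also have "\<dots> = real P * ((\<Sum>j<Q. D j) / N0)" by (simp add: sum_divide_distrib)
    also have "\<dots> = 1" unfolding s N0_def using pos Q0 by simp
    finally show ?thesis by simp
  qed
  have orth: "(\<Sum>z\<in>?Z. of_real (?w z) *
       (?\<phi> n1 z * ?\<phi> n2 z * ?\<phi> n3 z * cnj (?\<phi> m1 z * ?\<phi> m2 z * ?\<phi> m3 z))) = 0"
    if n: "n1 < N" "n2 < N" "n3 < N" "m1 < N" "m2 < N" "m3 < N"
      and ne: "n1 + n2 + n3 \<noteq> m1 + m2 + m3 \<or> 1 \<le> \<bar>?a n1 + ?a n2 + ?a n3 - (?a m1 + ?a m2 + ?a m3)\<bar>"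
    for n1 n2 n3 m1 m2 m3
  proof -
    define s where "s = int n1 + int n2 + int n3 - int m1 - int m2 - int m3"
    define d where "d = A n1 + A n2 + A n3 - A m1 - A m2 - A m3"
    have prod: "?\<phi> n1 z * ?\<phi> n2 z * ?\<phi> n3 z * cnj (?\<phi> m1 z * ?\<phi> m2 z * ?\<phi> m3 z)
       = e (real (fst z) * (of_int s / real P)) * e (real (snd z) * (of_int d / real Q))" for z
    proof -
      define u where "u = real (fst z) / real P"
      define v where "v = real (snd z) / real Q"
      have 1: "real (fst z) * (of_int s / real P) + real (snd z) * (of_int d / real Q)
         = of_int s * u + of_int d * v" by (simp add: u_def v_def mult.commute)
      show ?thesis
        unfolding complex_cnj_mult cnj_e e_add[symmetric] u_def[symmetric] v_def[symmetric] 1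
        by (rule arg_cong[where f = e]) (simp add: s_def d_def algebra_simps)
    qed
    have "(\<Sum>z\<in>?Z. of_real (?w z) *
         (?\<phi> n1 z * ?\<phi> n2 z * ?\<phi> n3 z * cnj (?\<phi> m1 z * ?\<phi> m2 z * ?\<phi> m3 z)))
       = (\<Sum>y<P. \<Sum>j<Q. e (real y * (of_int s / real P)) *
            (of_real (D j) * e (real j * (of_int d / real Q))) / of_real N0)"
      unfolding prod w sum.cartesian_product by (simp add: case_prod_unfold ac_simps)
    also have "\<dots> = (\<Sum>y<P. e (real y * (of_int s / real P))) *
         (\<Sum>j<Q. of_real (D j) * e (real j * (of_int d / real Q))) / of_real N0"
      by (simp only: sum_product sum_divide_distrib)
    also have "\<dots> = 0"
    proof (cases "s = 0")
      case False
      have "\<bar>s\<bar> < int P" using n P by (auto simp: s_def)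
      with False have "\<not> int P dvd s" using dvd_imp_le_int[of s "int P"] by fastforce
      then show ?thesis unfolding sum_e_root_of_unity[OF pos(2)] by simp
    next
      case True
      then have "n1 + n2 + n3 = m1 + m2 + m3" unfolding s_def by linarith
      with ne have "1 \<le> \<bar>?a n1 + ?a n2 + ?a n3 - (?a m1 + ?a m2 + ?a m3)\<bar>" by simp
      also have "?a n1 + ?a n2 + ?a n3 - (?a m1 + ?a m2 + ?a m3) = of_int d / real M"
        by (simp add: d_def diff_divide_distrib add_divide_distrib)
      finally have "real M \<le> real_of_int \<bar>d\<bar>" using pos by (simp add: le_divide_eq)
      \<comment> \<open>From below \<open>d\<close> escapes the range of the differences
        \<open>h - h'\<close>, so zero is not hit; from above \<open>3 * B + M \<le> Q\<close>
        prevents the other multiples of \<open>Q\<close> from being hit.\<close>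
      then have dM: "int M \<le> \<bar>d\<bar>" by linarith
      have dB: "\<bar>d\<bar> \<le> 3 * B" using B(1)[OF n(1) n(4)] B(1)[OF n(2) n(5)] B(1)[OF n(3) n(6)]
        unfolding d_def by linarith
      have "(\<Sum>j<Q. of_real (D j) * e (real j * (of_int d / real Q)))
         = (\<Sum>h<M. \<Sum>h'<M. if int Q dvd int h - int h' + d then of_nat Q else 0)"
        unfolding D_def by (rule sum_Fejer[OF Q0])
      also have "\<dots> = 0"
      proof (intro sum.neutral ballI)
        fix h h' assume "h \<in> {..<M}" "h' \<in> {..<M}"
        then have "\<bar>int h - int h'\<bar> < int M" by auto
        then have "int h - int h' + d \<noteq> 0" "\<bar>int h - int h' + d\<bar> < int Q"
          using dM dB Q by linarith+
        then have "\<not> int Q dvd int h - int h' + d"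
          using dvd_imp_le_int[of "int h - int h' + d" "int Q"] by fastforce
        then show "(if int Q dvd int h - int h' + d then of_nat Q else 0 :: complex) = 0" by simp
      qed
      finally show ?thesis by simp
    qed
    finally show ?thesis .
  qed
  show ?thesis
  proof unfold_locales
    fix i show "1 \<le> ?a (i + 2) - 2 * ?a (i + 1) + ?a i" by (rule s1)
    show "?a (i + 2) - 2 * ?a (i + 1) + ?a i \<le> real \<Lambda>" by (rule s2)
  next
    show "sum ?w ?Z \<le> 1" by (rule wsum)
  next
    fix z show "0 \<le> ?w z" by simp
  next
    fix n1 n2 n3 m1 m2 m3
    assume "n1 < N" "n2 < N" "n3 < N" "m1 < N" "m2 < N" "m3 < N"
      "n1 + n2 + n3 \<noteq> m1 + m2 + m3 \<or> 1 \<le> \<bar>?a n1 + ?a n2 + ?a n3 - (?a m1 + ?a m2 + ?a m3)\<bar>"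
    then show "(\<Sum>z\<in>?Z. of_real (?w z) *
       (?\<phi> n1 z * ?\<phi> n2 z * ?\<phi> n3 z * cnj (?\<phi> m1 z * ?\<phi> m2 z * ?\<phi> m3 z))) = 0"
      by (rule orth)
  qed auto
qed

section \<open>From uniformly convex sequences to integer frequencies\<close>

lemma norm_e_diff_le: "cmod (e x - e y) \<le> 2 * pi * \<bar>x - y\<bar>"
proof -
  have "e x - e y = e y * (e (x - y) - 1)"
    using e_add[of y "x - y"] by (simp add: algebra_simps)
  then have "cmod (e x - e y) = cmod (e (x - y) - 1)" by (simp add: norm_mult)
  also have "\<dots> \<le> \<bar>2 * pi * (x - y)\<bar>"
    unfolding e_eq_cis cis_conv_exp
    using abs_sin_x_le_abs_x[of "2 * pi * (x - y) / 2"] by (simp only: dist_exp_i_1)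
  finally show ?thesis by (simp add: abs_mult)
qed

text \<open>Phases within an eighth of a turn have cosine at least \<open>1 / sqrt 2\<close>, so
  nothing cancels. It serves both the Fejer weight near its peak and the Dirichlet kernel of the
  lower bound.\<close>

lemma norm_sum_e_ge:
  assumes "\<And>h. h \<in> S \<Longrightarrow> \<bar>x h\<bar> \<le> 1 / 8"
  shows "real (card S) / sqrt 2 \<le> cmod (\<Sum>h\<in>S. e (x h))"
proof (cases "finite S")
  case True
  have "real (card S) / sqrt 2 = (\<Sum>h\<in>S. cos (pi / 4))" by (simp add: cos_45 real_div_sqrt field_simps)
  also have "\<dots> \<le> (\<Sum>h\<in>S. Re (e (x h)))"
  proof (rule sum_mono)
    fix h assume "h \<in> S"
    then have "pi * (8 * \<bar>x h\<bar>) \<le> pi * 1" using assms[of h] by (intro mult_left_mono) auto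
    then have "cos (pi / 4) \<le> cos (2 * pi * \<bar>x h\<bar>)" by (intro cos_monotone_0_pi_le) auto
    also have "\<dots> = cos (2 * pi * x h)" by (cases "x h \<ge> 0") auto
    finally show "cos (pi / 4) \<le> Re (e (x h))" by (simp add: e_eq_cis)
  qed
  also have "\<dots> = Re (\<Sum>h\<in>S. e (x h))" by simp
  also have "\<dots> \<le> cmod (\<Sum>h\<in>S. e (x h))" by (rule complex_Re_le_cmod)
  finally show ?thesis .
qed auto

lemma floor_second_difference:
  fixes x y z :: real
  shows "x - 2 * y + z - 2 < of_int (\<lfloor>x\<rfloor> - 2 * \<lfloor>y\<rfloor> + \<lfloor>z\<rfloor>)"
    "of_int (\<lfloor>x\<rfloor> - 2 * \<lfloor>y\<rfloor> + \<lfloor>z\<rfloor>) < x - 2 * y + z + 2"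
  unfolding of_int_add of_int_diff of_int_mult of_int_numeral by linarith+

lemma uniformly_convex_range:
  assumes "uniformly_convex N a" "1 \<le> m" "m \<le> n" "n \<le> N"
  shows "0 \<le> a n - a m" "a n - a m \<le> 4"
proof -
  have "0 \<le> a (m + k) - a m \<and> a (m + k) - a m \<le> 4 / real N * real k" if "m + k \<le> N" for k
    using that
  proof (induction k)
    case (Suc k)
    have "1 \<le> m + k" "m + k + 1 \<le> N" using Suc.prems assms(2) by auto
    then have "a (m + k + 1) - a (m + k) \<in> {1 / (4 * real N)..4 / real N}"
      using assms(1) unfolding uniformly_convex_def by blast
    moreover have "1 / (4 * real N) \<ge> 0" by simp
    ultimately have "0 \<le> a (m + k + 1) - a (m + k)" "a (m + k + 1) - a (m + k) \<le> 4 / real N"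
      unfolding atLeastAtMost_iff by linarith+
    moreover have "0 \<le> a (m + k) - a m" "a (m + k) - a m \<le> 4 / real N * real k"
      using Suc by auto
    moreover have "4 / real N * real (Suc k) = 4 / real N * real k + 4 / real N"
      by (simp add: distrib_left)
    ultimately show ?case by simp
  qed auto
  from this[of "n - m"] have *: "0 \<le> a n - a m" "a n - a m \<le> 4 / real N * real (n - m)"
    using assms by auto
  have "4 / real N * real (n - m) \<le> 4 / real N * real N"
    using assms by (intro mult_left_mono) auto
  also have "\<dots> \<le> 4" by simp
  finally show "0 \<le> a n - a m" "a n - a m \<le> 4" using * by auto
qed

text \<open>
  The sequence \<open>a\<close> is rounded to multiples of \<open>1 / (64 * N ^ 3)\<close>, which changes the phase by
  \<open>O(1 / N)\<close> for times up to \<open>N\<^sup>2\<close>, and is continued beyond \<open>N\<close> with the smallest admissible second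
  difference. The times \<open>j / 16\<close> with \<open>j < 16 * N\<^sup>2\<close> lie where the Fejer weight is near its maximum.
\<close>

lemma discrete_sixth_moment:
  fixes \<epsilon> :: real
  assumes "\<epsilon> > 0"
  obtains C where "C > 0"
    "\<And>N a b x. \<lbrakk>N \<ge> 1; uniformly_convex N a\<rbrakk> \<Longrightarrow>
      (\<Sum>j<16 * N\<^sup>2. cmod (\<Sum>n=1..N. b n * e (x j * real n / real N + real j / 16 * a n)) ^ 6)
        \<le> C * real N powr (3 + \<epsilon>) * (\<Sum>n=1..N. (cmod (b n))\<^sup>2) ^ 3"
proof (rule sixth_moment_uniform[where 'z = "nat \<times> nat" and \<Lambda> = 33, OF assms])
  fix C0 :: real
  assume C0: "C0 > 0"
    "\<And>a (Z :: (nat \<times> nat) set) w \<phi> N b. \<lbrakk>exponential_system a 33 Z w \<phi> N; N \<ge> 1\<rbrakk> \<Longrightarrow>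
      (\<Sum>z\<in>Z. w z * cmod (\<Sum>n<N. b n * \<phi> n z) ^ 6)
        \<le> C0 * real N powr \<epsilon> * (\<Sum>n<N. (cmod (b n))\<^sup>2) ^ 3"
  show thesis
  proof (rule that[of "64 * (768 * C0 + 16)"])
    show "64 * (768 * C0 + 16) > 0" using C0 by simp
  next
    fix N :: nat and a :: "nat \<Rightarrow> real" and b :: "nat \<Rightarrow> complex" and x :: "nat \<Rightarrow> real"
    assume N: "N \<ge> 1" and uc: "uniformly_convex N a"
    define c where "c n = a (n + 1)" for n
    define b' where "b' n = b (n + 1)" for n
    define m where "m = (\<Sum>n<N. (cmod (b' n))\<^sup>2)"
    have m0: "m \<ge> 0" unfolding m_def by (intro sum_nonneg) auto
    have m: "(\<Sum>n=1..N. (cmod (b n))\<^sup>2) = m"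
      by (simp add: m_def b'_def sum.atLeast1_atMost_eq)
    \<comment> \<open>After scaling by \<open>R\<close> the second differences lie between
      \<open>16 * N\<close> and \<open>256 * N\<close>; rounding moves them by less than 2, hence
      they stay between \<open>M\<close> and \<open>33 * M\<close>. The choice
      \<open>Q = 16 * R\<close> turns the grid point \<open>j / Q\<close> into the time
      \<open>j / 16\<close>, and leaves room for \<open>3 * B + M \<le> Q\<close>.\<close>
    define M Q R where "M = 8 * N" and "Q = 1024 * N ^ 3" and "R = 64 * real N ^ 3"
    define s where "s n = \<lfloor>R * c n\<rfloor>" for n
    have N0: "real N > 0" using N by simp
    have "s (n + 2) - 2 * s (n + 1) + s n \<in> {int M..int 33 * int M}" if "n + 2 < N" for n
    proof -
      define d where "d = c (n + 2) - 2 * c (n + 1) + c n"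
      have "1 \<le> n + 1" "n + 1 + 2 \<le> N" using that by auto
      then have "(a (n + 1 + 2) - a (n + 1 + 1)) - (a (n + 1 + 1) - a (n + 1))
          \<in> {1 / (4 * (real N)^2) .. 4 / (real N)^2}"
        using uc unfolding uniformly_convex_def by blast
      then have d: "1 / (4 * (real N)^2) \<le> d" "d \<le> 4 / (real N)^2"
        by (simp_all add: d_def c_def add.commute numeral_eq_Suc algebra_simps)
      have R: "R * (1 / (4 * (real N)^2)) = 16 * real N" "R * (4 / (real N)^2) = 256 * real N" "R \<ge> 0"
        using N0 by (simp_all add: R_def power3_eq_cube power2_eq_square)
      have Rd: "16 * real N \<le> R * d" "R * d \<le> 256 * real N"
        using mult_left_mono[OF d(1) R(3)] mult_left_mono[OF d(2) R(3)] unfolding R(1,2) .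
      have eq: "R * c (n + 2) - 2 * (R * c (n + 1)) + R * c n = R * d"
        by (simp add: d_def algebra_simps)
      note fl = floor_second_difference[of "R * c (n + 2)" "R * c (n + 1)" "R * c n", folded s_def, unfolded eq]
      have "16 * real N - 2 < of_int (s (n + 2) - 2 * s (n + 1) + s n)"
        using fl(1) Rd(1) by linarith
      moreover have "of_int (s (n + 2) - 2 * s (n + 1) + s n) < 256 * real N + 2"
        using fl(2) Rd(2) by linarith
      ultimately have "16 * int N - 2 < s (n + 2) - 2 * s (n + 1) + s n"
        "s (n + 2) - 2 * s (n + 1) + s n < 256 * int N + 2"
        by linarith+
      then show ?thesis using N by (simp add: M_def)
    qed
    moreover have "int M \<le> int 33 * int M" by simp
    ultimately obtain A where A: "\<And>n. n < N \<Longrightarrow> A n = s n"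
      "\<And>n. A (n + 2) - 2 * A (n + 1) + A n \<in> {int M..int 33 * int M}"
      using extend_second_differences[of N s "int M" "int 33 * int M"] by blast
    define B where "B = 256 * int N ^ 3 + 1"
    have range1: "\<bar>A n - A m\<bar> \<le> B" if "n < N" "m \<le> n" for n m
    proof -
      have "0 \<le> c n - c m" "c n - c m \<le> 4"
        using uniformly_convex_range[OF uc, of "m + 1" "n + 1"] that by (auto simp: c_def)
      moreover have "R \<ge> 0" by (simp add: R_def)
      ultimately have "0 \<le> R * (c n - c m)" "R * (c n - c m) \<le> R * 4"
        by (blast intro: mult_nonneg_nonneg mult_left_mono)+
      then have "0 \<le> R * c n - R * c m" "R * c n - R * c m \<le> 256 * real N ^ 3"
        by (simp_all add: R_def algebra_simps)
      moreover have "256 * real N ^ 3 = of_int (256 * int N ^ 3)" by simp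
      ultimately show ?thesis using that A(1)[of n] A(1)[of m] unfolding s_def B_def by linarith
    qed
    have B: "\<bar>A n - A m\<bar> \<le> B" if "n < N" "m < N" for n m
      using range1[of n m] range1[of m n] that by (cases "m \<le> n") (auto simp: abs_minus_commute)
    have NN: "int N \<le> int N ^ 3" using N by (simp add: self_le_power)
    define w where "w z = (cmod (\<Sum>h<M. e (real h * (real (snd z) / real Q))))\<^sup>2
        / (real (3 * N) * real Q * real M)" for z :: "nat \<times> nat"
    define \<phi> where "\<phi> n z = e (real n * (real (fst z) / real (3 * N)) + of_int (A n) * (real (snd z) / real Q))"
      for n and z :: "nat \<times> nat"
    have sys: "exponential_system (\<lambda>n. of_int (A n) / real M) 33 ({..<3 * N} \<times> {..<Q}) w \<phi> N"
      unfolding w_def[abs_def] \<phi>_def[abs_def]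
    proof (rule Fejer_exponential_system)
      have "3 * B + int M = 768 * int N ^ 3 + 3 + 8 * int N" "int Q = 1024 * int N ^ 3"
        by (simp_all add: B_def M_def Q_def)
      moreover have "int N \<ge> 1" using N by simp
      ultimately show "3 * B + int M \<le> int Q" using NN by linarith
    qed (use N A(2) B in \<open>auto simp: M_def B_def\<close>)
    define T where "T = 16 * N\<^sup>2"
    \<comment> \<open>For \<open>h\<close> below \<open>M\<close> and \<open>j\<close> below
      \<open>T\<close> this gives phases \<open>h * j / Q\<close> of at most \<open>1 / 8\<close>,
      where the Fejer weight is comparable to its maximum.\<close>
    have TM: "8 * (T * M) = Q" by (simp add: T_def M_def Q_def power2_eq_square power3_eq_cube)
    have pos: "real M > 0" "real Q > 0" using N by (auto simp: M_def Q_def)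
    have "T * 1 \<le> T * (8 * M)" using N by (intro mult_le_mono) (auto simp: M_def)
    then have TQ: "T \<le> Q" unfolding TM[symmetric] by (simp add: ac_simps)
    have wge: "real M / (2 * real (3 * N) * real Q) \<le> w (y, j)" if "j < T" for y j
    proof -
      have "real (card {..<M}) / sqrt 2 \<le> cmod (\<Sum>h<M. e (real h * (real j / real Q)))"
      proof (rule norm_sum_e_ge)
        fix h assume "h \<in> {..<M}"
        then have "real h * real j \<le> real M * real T" using that by (intro mult_mono) auto
        also have "\<dots> = real Q / 8" using TM by (simp flip: TM)
        finally show "\<bar>real h * (real j / real Q)\<bar> \<le> 1 / 8" using pos by (simp add: field_simps)
      qed
      then have "(real M / sqrt 2)\<^sup>2 \<le> (cmod (\<Sum>h<M. e (real h * (real j / real Q))))\<^sup>2"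
        by (intro power_mono) auto
      then have "(real M / sqrt 2)\<^sup>2 / (real (3 * N) * real Q * real M) \<le> w (y, j)"
        unfolding w_def snd_conv by (intro divide_right_mono) auto
      moreover have "(real M / sqrt 2)\<^sup>2 / (real (3 * N) * real Q * real M) = real M / (2 * real (3 * N) * real Q)"
        using pos N by (simp add: power_divide power2_eq_square)
      ultimately show ?thesis by simp
    qed
    \<comment> \<open>With the time factor moved into the coefficients, each \<open>Gj j\<close> is
      a trigonometric polynomial in \<open>u\<close>; an arbitrary point chosen for each
      \<open>j\<close> can then be replaced by the grid of \<open>3 * N\<close> points.\<close>
    define Gj where "Gj j u = (\<Sum>n<N. (b' n * e (of_int (A n) * (real j / real Q))) * e (real n * u))" for j :: nat and u :: real
    have Gphi: "Gj j (real y / real (3 * N)) = (\<Sum>n<N. b' n * \<phi> n (y, j))" for y j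
      by (simp add: Gj_def \<phi>_def e_add ac_simps)
    have Gsum: "(\<Sum>j<T. cmod (Gj j (u j)) ^ 6) \<le> 768 * real N ^ 3 * (C0 * real N powr \<epsilon> * m ^ 3)" for u
    proof -
      define k where "k = real M / (2 * real (3 * N) * real Q)"
      \<comment> \<open>\<open>k\<close> is the lower bound for the weights with
        \<open>j < T\<close>; dividing by it produces the factor \<open>N ^ 3\<close> of the moment
        bound.\<close>
      have k: "k > 0" "1 / k = 768 * real N ^ 3" using N
        by (auto simp: k_def M_def Q_def field_simps)
      have "k * (\<Sum>j<T. cmod (Gj j (u j)) ^ 6) \<le> k * (\<Sum>j<T. \<Sum>y<3 * N. cmod (Gj j (real y / real (3 * N))) ^ 6)"
        using k unfolding Gj_def by (intro mult_left_mono sum_mono trig_sixth_power_le N) auto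
      also have "\<dots> = (\<Sum>j<T. \<Sum>y<3 * N. k * cmod (\<Sum>n<N. b' n * \<phi> n (y, j)) ^ 6)"
        unfolding Gphi by (simp add: sum_distrib_left)
      also have "\<dots> \<le> (\<Sum>j<T. \<Sum>y<3 * N. w (y, j) * cmod (\<Sum>n<N. b' n * \<phi> n (y, j)) ^ 6)"
        using wge unfolding k_def by (intro sum_mono mult_right_mono) auto
      also have "\<dots> \<le> (\<Sum>j<Q. \<Sum>y<3 * N. w (y, j) * cmod (\<Sum>n<N. b' n * \<phi> n (y, j)) ^ 6)"
        using TQ by (intro sum_mono2) (auto intro!: sum_nonneg mult_nonneg_nonneg simp: w_def)
      also have "\<dots> = (\<Sum>y<3 * N. \<Sum>j<Q. w (y, j) * cmod (\<Sum>n<N. b' n * \<phi> n (y, j)) ^ 6)"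
        by (rule sum.swap)
      also have "\<dots> = (\<Sum>z\<in>{..<3 * N} \<times> {..<Q}. w z * cmod (\<Sum>n<N. b' n * \<phi> n z) ^ 6)"
        unfolding sum.cartesian_product by (simp add: case_prod_unfold)
      also have "\<dots> \<le> C0 * real N powr \<epsilon> * m ^ 3"
        unfolding m_def by (rule C0(2)[OF sys N])
      finally have "(\<Sum>j<T. cmod (Gj j (u j)) ^ 6) \<le> (1 / k) * (C0 * real N powr \<epsilon> * m ^ 3)"
        using k(1) by (simp add: field_simps)
      then show ?thesis unfolding k(2) .
    qed
    have Fj: "cmod (\<Sum>n=1..N. b n * e (x j * real n / real N + real j / 16 * a n)) ^ 6
        \<le> 64 * (cmod (Gj j (x j / real N)) ^ 6 + m ^ 3)" if "j < T" for j
    proof -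
      define u where "u = x j / real N"
      define y where "y = cmod (\<Sum>n=1..N. b n * e (x j * real n / real N + real j / 16 * a n))"
      \<comment> \<open>Shifting the index range to start at 0 costs only the unimodular factor
        \<open>e u\<close>.\<close>
      have "(\<Sum>n=1..N. b n * e (x j * real n / real N + real j / 16 * a n))
          = e u * (\<Sum>n<N. b' n * e (real n * u) * e (real j / 16 * c n))"
        unfolding sum_distrib_left
        by (simp add: sum.atLeast1_atMost_eq b'_def c_def u_def algebra_simps add_divide_distrib flip: e_add)
      then have "y = cmod (\<Sum>n<N. b' n * e (real n * u) * e (real j / 16 * c n))"
        by (simp add: y_def norm_mult)
      also have "\<dots> = cmod (Gj j u + (\<Sum>n<N. b' n * e (real n * u) *
            (e (real j / 16 * c n) - e (of_int (A n) * (real j / real Q)))))"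
        unfolding Gj_def sum.distrib[symmetric] by (simp add: algebra_simps)
      also have "\<dots> \<le> cmod (Gj j u) + (\<Sum>n<N. 1 / real N * cmod (b' n))"
      proof (rule order_trans[OF norm_triangle_ineq add_left_mono], rule sum_norm_le)
        fix n assume n: "n \<in> {..<N}"
        \<comment> \<open>The rounding error in the phase is a fractional part times
          \<open>j / Q\<close>, which is at most \<open>1 / (64 * N)\<close>; each term thus changes
          by at most \<open>cmod (b' n) / N\<close>.\<close>
        have "real j / 16 * c n - of_int (A n) * (real j / real Q) = real j / real Q * (R * c n - of_int \<lfloor>R * c n\<rfloor>)"
          using n A(1) N0 by (simp add: s_def R_def Q_def field_simps)
        moreover have "\<bar>R * c n - of_int \<lfloor>R * c n\<rfloor>\<bar> \<le> 1" by linarith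
        ultimately have "\<bar>real j / 16 * c n - of_int (A n) * (real j / real Q)\<bar> \<le> real j / real Q * 1"
          using mult_left_mono[of "\<bar>R * c n - of_int \<lfloor>R * c n\<rfloor>\<bar>" 1 "real j / real Q"]
          by (simp only: abs_mult) simp
        also have "\<dots> \<le> 1 / (64 * real N)"
        proof -
          have "real j \<le> real T" using that by simp
          also have "\<dots> * (64 * real N) = real Q" by (simp add: T_def Q_def power2_eq_square power3_eq_cube)
          finally show ?thesis using pos N0 by (simp add: field_simps)
        qed
        finally have "2 * pi * \<bar>real j / 16 * c n - of_int (A n) * (real j / real Q)\<bar> \<le> (2 * pi) * (1 / (64 * real N))"
          by (intro mult_left_mono) auto
        also have "\<dots> \<le> 64 * (1 / (64 * real N))"
          using pi_less_4 N0 by (intro mult_right_mono) auto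
        finally have "cmod (e (real j / 16 * c n) - e (of_int (A n) * (real j / real Q))) \<le> 1 / real N"
          using norm_e_diff_le order_trans by fastforce
        then have "cmod (b' n) * cmod (e (real j / 16 * c n) - e (of_int (A n) * (real j / real Q))) \<le> cmod (b' n) * (1 / real N)"
          by (intro mult_left_mono) auto
        then show "cmod (b' n * e (real n * u) * (e (real j / 16 * c n) - e (of_int (A n) * (real j / real Q))))
            \<le> 1 / real N * cmod (b' n)" by (simp add: norm_mult mult.commute)
      qed
      also have "(\<Sum>n<N. 1 / real N * cmod (b' n)) \<le> sqrt m"
      proof (rule real_le_rsqrt)
        have "(\<Sum>n<N. 1 / real N * cmod (b' n))\<^sup>2 \<le> (\<Sum>n<N. (1 / real N)\<^sup>2) * m"
          unfolding m_def by (rule Cauchy_Schwarz_ineq_sum)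
        also have "(\<Sum>n<N. (1 / real N)\<^sup>2) = 1 / real N" using N0 by (simp add: power2_eq_square)
        also have "1 / real N * m \<le> 1 * m" using N m0 by (intro mult_right_mono) auto
        finally show "(\<Sum>n<N. 1 / real N * cmod (b' n))\<^sup>2 \<le> m" by simp
      qed
      finally have y: "y \<le> cmod (Gj j u) + sqrt m" by simp
      have "y ^ 6 \<le> (cmod (Gj j u) + sqrt m) ^ 6" using y by (intro power_mono) (auto simp: y_def)
      \<comment> \<open>The two summands are indexed by truth values so that
        \<open>sum_pow_le_card_pow\<close> applies with two terms.\<close>
      also have "\<dots> = (\<Sum>i\<in>{True, False}. if i then cmod (Gj j u) else sqrt m) ^ 6" by simp
      also have "\<dots> \<le> real 2 ^ 6 * (\<Sum>i\<in>{True, False}. (if i then cmod (Gj j u) else sqrt m) ^ 6)"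
        using m0 by (intro sum_pow_le_card_pow) auto
      also have "\<dots> = 64 * (cmod (Gj j u) ^ 6 + m ^ 3)"
      proof -
        have "sqrt m ^ 6 = (sqrt m ^ 2) ^ 3" by (simp flip: power_mult)
        then show ?thesis using m0 by simp
      qed
      finally show ?thesis by (simp add: y_def u_def)
    qed
    have "(\<Sum>j<T. cmod (\<Sum>n=1..N. b n * e (x j * real n / real N + real j / 16 * a n)) ^ 6)
        \<le> (\<Sum>j<T. 64 * (cmod (Gj j (x j / real N)) ^ 6 + m ^ 3))"
      by (intro sum_mono Fj) auto
    also have "\<dots> = 64 * ((\<Sum>j<T. cmod (Gj j (x j / real N)) ^ 6) + real T * m ^ 3)"
      by (simp add: sum.distrib flip: sum_distrib_left)
    also have "\<dots> \<le> 64 * (768 * real N ^ 3 * (C0 * real N powr \<epsilon> * m ^ 3) + 16 * (real N ^ 3 * real N powr \<epsilon>) * m ^ 3)"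
    proof (intro mult_left_mono add_mono Gsum mult_right_mono)
      have "real N ^ 2 * 1 \<le> real N ^ 3 * real N powr \<epsilon>"
        using N assms by (intro mult_mono power_increasing ge_one_powr_ge_zero) auto
      then show "real T \<le> 16 * (real N ^ 3 * real N powr \<epsilon>)" by (simp add: T_def)
    qed (use m0 in auto)
    also have "\<dots> = 64 * (768 * C0 + 16) * (real N ^ 3 * real N powr \<epsilon>) * m ^ 3"
      by (simp add: algebra_simps)
    also have "real N ^ 3 * real N powr \<epsilon> = real N powr (3 + \<epsilon>)"
      using N0 by (simp add: powr_add)
    finally show "(\<Sum>j<16 * N\<^sup>2. cmod (\<Sum>n=1..N. b n * e (x j * real n / real N + real j / 16 * a n)) ^ 6)
        \<le> 64 * (768 * C0 + 16) * real N powr (3 + \<epsilon>) * (\<Sum>n=1..N. (cmod (b n))\<^sup>2) ^ 3"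
      unfolding m T_def .
  qed
qed

section \<open>The maximal function\<close>

definition expsum :: "nat \<Rightarrow> (nat \<Rightarrow> real) \<Rightarrow> (nat \<Rightarrow> complex) \<Rightarrow> real \<Rightarrow> real \<Rightarrow> complex" where
  "expsum N a b t x = (\<Sum>n=1..N. b n * e (x * real n / real N + t * a n))"

lemma maxfun_eq_SUP: "maxfun N a b t = (SUP x\<in>{0..real N}. cmod (expsum N a b t x))"
  by (simp add: maxfun_def expsum_def)

lemma continuous_on_e [continuous_intros]:
  "continuous_on S f \<Longrightarrow> continuous_on S (\<lambda>x. e (f x))"
  unfolding e_def by (intro continuous_intros)

lemma expsum_bounded: "cmod (expsum N a b t x) \<le> (\<Sum>n=1..N. cmod (b n))"
  unfolding expsum_def by (rule sum_norm_le) (simp add: norm_mult)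

lemma bdd_above_expsum: "bdd_above ((\<lambda>x. cmod (expsum N a b t x)) ` S)"
  using expsum_bounded by (intro bdd_aboveI) auto

text \<open>Compactness provides a maximising \<open>x\<close> for every time; these are the free
  points \<open>x j\<close> of \<open>discrete_sixth_moment\<close>.\<close>

lemma maxfun_attained:
  obtains x where "x \<in> {0..real N}" "maxfun N a b t = cmod (expsum N a b t x)"
proof -
  have "continuous_on {0..real N} (\<lambda>x. cmod (expsum N a b t x))"
    unfolding expsum_def by (intro continuous_intros) auto
  then obtain x where x: "x \<in> {0..real N}"
    "\<forall>y\<in>{0..real N}. cmod (expsum N a b t y) \<le> cmod (expsum N a b t x)"
    using continuous_attains_sup[of "{0..real N}" "\<lambda>x. cmod (expsum N a b t x)"] by auto
  then have "maxfun N a b t = cmod (expsum N a b t x)"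
    unfolding maxfun_eq_SUP by (intro cSup_eq_maximum) auto
  with x(1) show thesis by (rule that)
qed

lemma norm_expsum_le_maxfun:
  assumes "x \<in> {0..real N}"
  shows "cmod (expsum N a b t x) \<le> maxfun N a b t"
  unfolding maxfun_eq_SUP by (rule cSUP_upper[OF assms bdd_above_expsum])

lemma maxfun_nonneg: "0 \<le> maxfun N a b t"
  by (rule order_trans[OF norm_ge_zero norm_expsum_le_maxfun[of 0]]) simp

text \<open>The exponential sum is Lipschitz in \<open>t\<close> with a constant independent of
  \<open>x\<close>, and the supremum inherits it.\<close>

lemma continuous_on_maxfun: "continuous_on S (maxfun N a b)"
proof -
  define L where "L = (\<Sum>n=1..N. cmod (b n) * (2 * pi * \<bar>a n\<bar>))"
  have L: "L \<ge> 0" unfolding L_def by (intro sum_nonneg) auto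
  have step: "maxfun N a b t - maxfun N a b s \<le> L * \<bar>t - s\<bar>" for t s
  proof (rule maxfun_attained[of N a b t])
    fix x assume x: "x \<in> {0..real N}" "maxfun N a b t = cmod (expsum N a b t x)"
    have "cmod (expsum N a b t x - expsum N a b s x) \<le> (\<Sum>n=1..N. cmod (b n) * (2 * pi * \<bar>a n\<bar>) * \<bar>t - s\<bar>)"
      unfolding expsum_def sum_subtractf[symmetric]
    proof (rule sum_norm_le)
      fix n
      let ?u = "x * real n / real N + t * a n" and ?v = "x * real n / real N + s * a n"
      have "cmod (b n * e ?u - b n * e ?v) = cmod (b n) * cmod (e ?u - e ?v)"
        by (simp add: norm_mult flip: right_diff_distrib)
      also have "\<dots> \<le> cmod (b n) * (2 * pi * \<bar>?u - ?v\<bar>)"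
        by (intro mult_left_mono norm_e_diff_le) auto
      also have "\<bar>?u - ?v\<bar> = \<bar>a n\<bar> * \<bar>t - s\<bar>" by (simp add: abs_mult flip: left_diff_distrib)
      finally show "cmod (b n * e ?u - b n * e ?v) \<le> cmod (b n) * (2 * pi * \<bar>a n\<bar>) * \<bar>t - s\<bar>"
        by (simp add: mult.assoc)
    qed
    also have "\<dots> = L * \<bar>t - s\<bar>" by (simp add: L_def sum_distrib_right)
    finally have "cmod (expsum N a b t x) - cmod (expsum N a b s x) \<le> L * \<bar>t - s\<bar>"
      using norm_triangle_ineq2 order_trans by blast
    then show ?thesis using x norm_expsum_le_maxfun[OF x(1), of a b s] by linarith
  qed
  have "L-lipschitz_on S (maxfun N a b)"
  proof (rule lipschitz_onI[OF _ L])
    fix s t show "dist (maxfun N a b s) (maxfun N a b t) \<le> L * dist s t"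
      using step[of s t] step[of t s] by (simp add: dist_real_def abs_minus_commute abs_le_iff)
  qed
  then show ?thesis by (rule lipschitz_on_continuous_on)
qed

lemma L4norm_eq:
  "L4norm N a b = (integral {0..(real N)\<^sup>2} (\<lambda>t. maxfun N a b t ^ 4)) powr (1/4)"
proof -
  have "set_integrable lborel {0..(real N)\<^sup>2} (\<lambda>t. maxfun N a b t ^ 4)"
    by (intro borel_integrable_atLeastAtMost' continuous_intros continuous_on_maxfun)
  then show ?thesis unfolding L4norm_def by (simp add: set_borel_integral_eq_integral)
qed

text \<open>Folds \<open>n\<close> consecutive intervals onto the first one. The upper bound uses
  the length \<open>1 / 16\<close> of the time grid, the lower bound the period \<open>1 / c\<close>
  of the Dirichlet kernel.\<close>

lemma integral_periods:
  fixes g :: "real \<Rightarrow> real"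
  assumes "continuous_on UNIV g" "p \<ge> 0"
  shows "integral {0..real n * p} g = integral {0..p} (\<lambda>t. \<Sum>j<n. g (t + real j * p))"
proof -
  have int: "g integrable_on {u..v}" for u v
    by (rule integrable_continuous_real) (rule continuous_on_subset[OF assms(1)], simp)
  have shift: "integral {0..p} (\<lambda>t. g (t + c)) = integral {c..p + c} g" for c
    using integral_shift_Icc_real[of 0 p g c] by (simp add: o_def add.commute)
  have "integral {0..real n * p} g = (\<Sum>j<n. integral {0..p} (\<lambda>t. g (t + real j * p)))"
  proof (induction n)
    case (Suc n)
    have "integral {0..real (Suc n) * p} g = integral {0..real n * p} g + integral {real n * p..real (Suc n) * p} g"
      using assms(2) by (intro Henstock_Kurzweil_Integration.integral_combine[symmetric] int) (auto intro!: mult_right_mono)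
    also have "integral {real n * p..real (Suc n) * p} g = integral {0..p} (\<lambda>t. g (t + real n * p))"
      unfolding shift by (simp add: algebra_simps)
    finally show ?case using Suc by simp
  qed simp
  also have "\<dots> = integral {0..p} (\<lambda>t. \<Sum>j<n. g (t + real j * p))"
    by (intro integral_sum[symmetric] integrable_continuous_real continuous_on_compose2[OF assms(1)] continuous_intros) auto
  finally show ?thesis .
qed

lemma l2norm_square: "(l2norm N b)\<^sup>2 = (\<Sum>n=1..N. (cmod (b n))\<^sup>2)"
  unfolding l2norm_def by (simp add: sum_nonneg)

lemma l2norm_nonneg: "l2norm N b \<ge> 0"
  unfolding l2norm_def by (simp add: sum_nonneg)

section \<open>Upper bound: from the sixth moment on time grids to the \<open>L4norm\<close>\<close>

lemma maximal_upper_bound: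
  fixes \<epsilon> :: real
  assumes "\<epsilon> > 0"
  shows "\<exists>C>0. \<forall>N::nat. N \<ge> 1 \<longrightarrow> (\<forall>a b. uniformly_convex N a \<longrightarrow>
            L4norm N a b \<le> C * real N powr \<epsilon> * real N powr (2/3) * l2norm N b)"
proof (rule discrete_sixth_moment[OF assms])
  fix C0 :: real
  assume C0: "C0 > 0" "\<And>N a b x. \<lbrakk>N \<ge> 1; uniformly_convex N a\<rbrakk> \<Longrightarrow>
      (\<Sum>j<16 * N\<^sup>2. cmod (\<Sum>n=1..N. b n * e (x j * real n / real N + real j / 16 * a n)) ^ 6)
        \<le> C0 * real N powr (3 + \<epsilon>) * (\<Sum>n=1..N. (cmod (b n))\<^sup>2) ^ 3"
  define C where "C = (16 + C0) powr (1/4)"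
  have "L4norm N a b \<le> C * real N powr \<epsilon> * real N powr (2/3) * l2norm N b"
    if N: "N \<ge> 1" and uc: "uniformly_convex N a" for N a b
  proof -
    define r where "r = real N"
    have r1: "r \<ge> 1" using N by (simp add: r_def)
    define l where "l = l2norm N b"
    have l0: "l \<ge> 0" unfolding l_def by (rule l2norm_nonneg)
    define I where "I = integral {0..(real N)\<^sup>2} (\<lambda>t. maxfun N a b t ^ 4)"
    define E where "E = (16 + C0) * r powr \<epsilon> * r powr (8/3) * l ^ 4"
    have E0: "E \<ge> 0" using C0 by (simp add: E_def)
    have sums: "(\<Sum>j<16 * N\<^sup>2. maxfun N a b (t + real j * (1/16)) ^ 4) \<le> E" for t
    proof -
      define y where "y j = (SOME x. maxfun N a b (t + real j * (1/16)) = cmod (expsum N a b (t + real j * (1/16)) x))" for j :: nat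
      have y: "maxfun N a b (t + real j * (1/16)) = cmod (expsum N a b (t + real j * (1/16)) (y j))" for j :: nat
        unfolding y_def by (rule someI_ex) (use maxfun_attained in metis)
      define u where "u j = maxfun N a b (t + real j * (1/16))" for j :: nat
      have u0: "u j \<ge> 0" for j unfolding u_def by (rule maxfun_nonneg)
      have six: "(\<Sum>j<16 * N\<^sup>2. u j ^ 6) \<le> C0 * r powr (3 + \<epsilon>) * l ^ 6"
      proof -
        \<comment> \<open>The offset \<open>t\<close> of the grid is a modulation of the
          coefficients, which preserves their moduli.\<close>
        define b' where "b' n = b n * e (t * a n)" for n
        have "expsum N a b (t + real j * (1/16)) (y j)
            = (\<Sum>n=1..N. b' n * e (y j * real n / real N + real j / 16 * a n))" for j
          unfolding expsum_def b'_def by (intro sum.cong refl) (simp add: algebra_simps flip: e_add)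
        then have "(\<Sum>j<16 * N\<^sup>2. u j ^ 6)
           = (\<Sum>j<16 * N\<^sup>2. cmod (\<Sum>n=1..N. b' n * e (y j * real n / real N + real j / 16 * a n)) ^ 6)"
          unfolding u_def y by simp
        also have "\<dots> \<le> C0 * real N powr (3 + \<epsilon>) * (\<Sum>n=1..N. (cmod (b' n))\<^sup>2) ^ 3"
          by (rule C0(2)[OF N uc])
        also have "(\<Sum>n=1..N. (cmod (b' n))\<^sup>2) = l\<^sup>2"
          unfolding l_def l2norm_square by (simp add: b'_def norm_mult)
        finally show ?thesis by (simp add: r_def flip: power_mult)
      qed
      show ?thesis
      proof (cases "l = 0")
        case True
        then have "(\<Sum>j<16 * N\<^sup>2. u j ^ 6) \<le> 0" using six by simp
        moreover have "(\<Sum>j<16 * N\<^sup>2. u j ^ 6) \<ge> 0" using u0 by (intro sum_nonneg) auto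
        ultimately have "(\<Sum>j<16 * N\<^sup>2. u j ^ 6) = 0" by linarith
        then have "\<forall>j\<in>{..<16 * N\<^sup>2}. u j ^ 6 = 0"
          using u0 by (subst (asm) sum_nonneg_eq_0_iff) auto
        then have "(\<Sum>j<16 * N\<^sup>2. u j ^ 4) = 0" by (intro sum.neutral) auto
        then show ?thesis using E0 by (simp add: u_def)
      next
        case False
        with l0 have l: "l > 0" by simp
        \<comment> \<open>the level at which the trivial bound for the number of times and the sixth moment agree\<close>
        define lam where "lam = r powr (1/3) * l\<^sup>2"
        have lam: "lam > 0" using r1 l by (simp add: lam_def)
        \<comment> \<open>Splitting at this level plays the part of Hoelder's inequality between the
          fourth and sixth moments.\<close>
        have pt: "u j ^ 4 \<le> lam\<^sup>2 + u j ^ 6 / lam" for j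
        proof (cases "(u j)\<^sup>2 \<le> lam")
          case True
          then have "((u j)\<^sup>2)\<^sup>2 \<le> lam\<^sup>2" by (intro power_mono) auto
          moreover have "u j ^ 6 / lam \<ge> 0" using u0[of j] lam by simp
          moreover have "((u j)\<^sup>2)\<^sup>2 = u j ^ 4" by (simp flip: power_mult)
          ultimately show ?thesis by linarith
        next
          case False
          then have "u j ^ 4 * lam \<le> u j ^ 4 * (u j)\<^sup>2" using u0[of j] by (intro mult_left_mono) auto
          also have "\<dots> = u j ^ 6" by (simp flip: power_add)
          finally have "u j ^ 4 \<le> u j ^ 6 / lam" using lam by (simp add: le_divide_eq)
          moreover have "lam\<^sup>2 \<ge> 0" by simp
          ultimately show ?thesis by linarith
        qed
        have "(\<Sum>j<16 * N\<^sup>2. u j ^ 4) \<le> (\<Sum>j<16 * N\<^sup>2. lam\<^sup>2 + u j ^ 6 / lam)"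
          by (intro sum_mono pt)
        also have "\<dots> = 16 * r\<^sup>2 * lam\<^sup>2 + (\<Sum>j<16 * N\<^sup>2. u j ^ 6) / lam"
          by (simp add: sum.distrib sum_divide_distrib r_def)
        also have "\<dots> \<le> 16 * r\<^sup>2 * lam\<^sup>2 + C0 * r powr (3 + \<epsilon>) * l ^ 6 / lam"
          using six lam by (intro add_left_mono divide_right_mono) auto
        also have "\<dots> = (16 + C0 * r powr \<epsilon>) * (r powr (8/3) * l ^ 4)"
        proof -
          have "r\<^sup>2 * lam\<^sup>2 = r powr (8/3) * l ^ 4"
          proof -
            have "r\<^sup>2 * (r powr (1/3))\<^sup>2 = r powr 2 * (r powr (1/3) * r powr (1/3))"
              using r1 by (simp add: power2_eq_square powr_numeral)
            also have "\<dots> = r powr (8/3)" by (simp flip: powr_add)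
            finally have 1: "r\<^sup>2 * (r powr (1/3))\<^sup>2 = r powr (8/3)" .
            have "r\<^sup>2 * lam\<^sup>2 = (r\<^sup>2 * (r powr (1/3))\<^sup>2) * l ^ 4"
              by (simp add: lam_def power_mult_distrib flip: power_mult)
            then show ?thesis unfolding 1 .
          qed
          moreover have "r powr (3 + \<epsilon>) * l ^ 6 / lam = r powr \<epsilon> * (r powr (8/3) * l ^ 4)"
          proof -
            have "r powr (3 + \<epsilon>) = r powr (1/3) * (r powr \<epsilon> * r powr (8/3))"
              by (simp flip: powr_add)
            moreover have "l ^ 6 = l\<^sup>2 * l ^ 4" by (simp flip: power_add)
            ultimately have "r powr (3 + \<epsilon>) * l ^ 6 = (r powr \<epsilon> * (r powr (8/3) * l ^ 4)) * lam"
              by (simp only: lam_def ac_simps)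
            then show ?thesis using lam by (simp only: nonzero_mult_div_cancel_right)
          qed
          moreover have "16 * r\<^sup>2 * lam\<^sup>2 + C0 * r powr (3 + \<epsilon>) * l ^ 6 / lam
              = 16 * (r\<^sup>2 * lam\<^sup>2) + C0 * (r powr (3 + \<epsilon>) * l ^ 6 / lam)"
            by (simp only: mult.assoc times_divide_eq_right)
          ultimately show ?thesis by (simp only: distrib_right mult.assoc)
        qed
        also have "\<dots> \<le> ((16 + C0) * r powr \<epsilon>) * (r powr (8/3) * l ^ 4)"
        proof (intro mult_right_mono)
          have "16 * 1 \<le> 16 * r powr \<epsilon>" using r1 assms by (intro mult_left_mono ge_one_powr_ge_zero) auto
          then show "16 + C0 * r powr \<epsilon> \<le> (16 + C0) * r powr \<epsilon>" by (simp add: algebra_simps)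
        qed auto
        finally show ?thesis by (simp add: u_def E_def mult.assoc)
      qed
    qed
    have cont: "continuous_on S (\<lambda>t. maxfun N a b t ^ 4)" for S
      by (intro continuous_intros continuous_on_maxfun)
    have "I = integral {0..real (16 * N\<^sup>2) * (1/16)} (\<lambda>t. maxfun N a b t ^ 4)" by (simp add: I_def)
    also have "\<dots> = integral {0..1/16} (\<lambda>t. \<Sum>j<16 * N\<^sup>2. maxfun N a b (t + real j * (1/16)) ^ 4)"
      by (rule integral_periods[OF cont]) simp
    also have "\<dots> \<le> integral {0..1/16::real} (\<lambda>t. E)"
      by (intro integral_le integrable_continuous_real continuous_intros
          continuous_on_compose2[OF continuous_on_maxfun[of UNIV]] sums) auto
    also have "\<dots> \<le> E" using E0 by simp
    finally have "I \<le> E" .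
    moreover have "I \<ge> 0" unfolding I_def
      by (intro integral_nonneg integrable_continuous_real cont) auto
    ultimately have "L4norm N a b \<le> E powr (1/4)"
      unfolding L4norm_eq I_def[symmetric] by (intro powr_mono2) auto
    \<comment> \<open>The fourth root turns \<open>8/3\<close> into \<open>2/3\<close>; the
      remaining exponent \<open>\<epsilon>/4\<close> is then weakened to
      \<open>\<epsilon>\<close>.\<close>
    also have "\<dots> = C * r powr (\<epsilon>/4) * r powr (2/3) * l"
      using C0 r1 l0 by (simp add: E_def C_def powr_mult powr_powr flip: powr_numeral)
    also have "\<dots> \<le> C * r powr \<epsilon> * r powr (2/3) * l"
      using r1 assms l0 by (intro mult_right_mono mult_left_mono powr_mono) (auto simp: C_def)
    finally show ?thesis unfolding r_def l_def .
  qed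
  moreover have "C > 0" using C0 by (simp add: C_def)
  ultimately show ?thesis by blast
qed

section \<open>Lower bound: square-root phases with an aligned subsequence\<close>

lemma sqrt_first_difference:
  assumes "z > 0"
  shows "sqrt (z + 1) - sqrt z = 1 / (sqrt (z + 1) + sqrt z)"
proof -
  have "(sqrt (z + 1) - sqrt z) * (sqrt (z + 1) + sqrt z) = 1"
    using assms by (simp add: algebra_simps)
  moreover have "sqrt (z + 1) + sqrt z > 0" using assms by (intro add_pos_pos) auto
  ultimately show ?thesis by (simp add: eq_divide_eq)
qed

text \<open>Rationalising twice yields an exact quotient, so bounds on the three roots give both
  bounds on the second difference.\<close>

lemma sqrt_second_difference:
  assumes "z > 0"
  shows "(sqrt (z + 1) - sqrt z) - (sqrt (z + 2) - sqrt (z + 1))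
    = 2 / ((sqrt (z + 1) + sqrt z) * (sqrt (z + 2) + sqrt (z + 1)) * (sqrt (z + 2) + sqrt z))"
proof -
  define p q r where "p = sqrt z" and "q = sqrt (z + 1)" and "r = sqrt (z + 2)"
  have pos: "p > 0" "q > 0" "r > 0" using assms by (auto simp: p_def q_def r_def)
  have 1: "q - p = 1 / (q + p)" using sqrt_first_difference[OF assms] by (simp add: p_def q_def)
  have 2: "r - q = 1 / (r + q)" using sqrt_first_difference[of "z + 1"] assms by (simp add: r_def q_def add.commute)
  have "(r - p) * (r + p) = 2" using assms by (simp add: algebra_simps p_def r_def)
  then have 3: "r - p = 2 / (r + p)" using pos by (simp add: eq_divide_eq)
  have "(q - p) - (r - q) = (r - p) / ((q + p) * (r + q))"
    unfolding 1 2 using pos by (simp add: divide_simps)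
  also have "\<dots> = 2 / ((q + p) * (r + q) * (r + p))" unfolding 3 by (simp add: ac_simps)
  finally show ?thesis unfolding p_def q_def r_def .
qed

text \<open>About \<open>N ^ 2 * c\<close> periods each contain an interval of length
  \<open>1 / (8 * c * M)\<close> on which the maximal function is comparable to \<open>M\<close>.
  The fourth moment is thus at least a multiple of \<open>N ^ 2 * M ^ 3\<close>; its fourth root
  divided by \<open>sqrt M\<close> is \<open>sqrt N * M powr (1/4)\<close>, which is of order
  \<open>N powr (5/8)\<close> since \<open>M\<close> is of order \<open>sqrt N\<close>.\<close>

lemma maximal_lower_bound:
  fixes N :: nat
  assumes N: "N \<ge> 10"
  shows "\<exists>a b. uniformly_convex N a \<and> l2norm N b > 0 \<and>
    L4norm N a b \<ge> 1 / 8 * real N powr (5/8) * l2norm N b"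
proof -
  define s where "s = sqrt (real N)"
  have s2: "s\<^sup>2 = real N" by (simp add: s_def)
  have s3: "s > 3" unfolding s_def using N by (intro real_less_rsqrt) auto
  define J where "J = nat \<lceil>s\<rceil>"
  have J: "s \<le> real J" "real J < s + 1" using s3 unfolding J_def by linarith+
  \<comment> \<open>With all roots between \<open>s\<close> and \<open>7/4 * s\<close>, the first
    differences of the root term then lie between \<open>1 / N\<close> and \<open>4 / N\<close>.
    Subtracted from the slope \<open>5 / N\<close> they leave values in the admissible range, and
    the minus sign makes the concave root convex.\<close>
  define c where "c = 8 / s"
  have c: "c > 0" using s3 by (simp add: c_def)
  define a where "a n = 5 * real n / real N - c * sqrt ((real J)\<^sup>2 + real n)" for n
  \<comment> \<open>Small enough for the last index \<open>M ^ 2 + 2 * J * M\<close> to be at most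
    \<open>N\<close>.\<close>
  define M where "M = nat \<lfloor>s / 3\<rfloor>"
  have M: "real M \<le> s / 3" "s / 3 < real M + 1" "M \<ge> 1" using s3 unfolding M_def by linarith+
  have Ms: "s \<le> 6 * real M" using M by linarith
  have J2: "real N \<le> (real J)\<^sup>2" "(real J)\<^sup>2 \<le> 2 * real N"
  proof -
    show "real N \<le> (real J)\<^sup>2" unfolding s2[symmetric] using J s3 by (intro power_mono) auto
    have "(real J)\<^sup>2 \<le> (s + 1)\<^sup>2" using J by (intro power_mono) auto
    also have "\<dots> = s * s + 2 * s + 1" by (simp add: power2_eq_square algebra_simps)
    also have "3 * s \<le> s * s" using s3 by (intro mult_right_mono) auto
    then have "s * s + 2 * s + 1 \<le> 2 * (s * s)" using s3 by linarith
    also have "\<dots> = 2 * real N" by (simp add: power2_eq_square flip: s2)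
    finally show "(real J)\<^sup>2 \<le> 2 * real N" .
  qed
  \<comment> \<open>\<open>7/4\<close> is a rational upper bound for \<open>sqrt 3\<close>.\<close>
  have root: "s \<le> sqrt w" "sqrt w \<le> 7/4 * s" if "real N \<le> w" "w \<le> 3 * real N" for w
  proof -
    show "s \<le> sqrt w" unfolding s_def using that by simp
    have "(7/4 * s)\<^sup>2 = 49/16 * real N" by (simp add: power2_eq_square flip: s2)
    then have "w \<le> (7/4 * s)\<^sup>2" using that by simp
    then show "sqrt w \<le> 7/4 * s" using s3 by (intro real_le_lsqrt) auto
  qed
  have uc: "uniformly_convex N a"
    unfolding uniformly_convex_def
  proof (intro conjI allI impI)
    fix n assume n: "1 \<le> n \<and> n + 1 \<le> N"
    define z where "z = (real J)\<^sup>2 + real n"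
    have "real n + 1 \<le> real N" using n by linarith
    then have z: "real N \<le> z" "z + 1 \<le> 3 * real N" using J2 of_nat_0_le_iff[of n] unfolding z_def by linarith+
    define u where "u = sqrt (z + 1) + sqrt z"
    have u: "2 * s \<le> u" "u \<le> 7/2 * s" using root[of z] root[of "z + 1"] z unfolding u_def by linarith+
    have "z > 0" using z N by linarith
    have "a (n + 1) - a n = 5 / real N - c * (sqrt (z + 1) - sqrt z)"
      by (simp add: a_def z_def algebra_simps add_divide_distrib)
    then have "a (n + 1) - a n = 5 / real N - c * (1 / u)"
      unfolding u_def sqrt_first_difference[OF \<open>z > 0\<close>] .
    moreover have "c * (1 / u) \<le> 4 / real N"
    proof -
      have "c * (1 / u) \<le> c * (1 / (2 * s))" using u s3 c by (intro mult_left_mono divide_left_mono mult_pos_pos) auto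
      also have "\<dots> = 4 / real N" by (simp add: c_def power2_eq_square flip: s2)
      finally show ?thesis .
    qed
    moreover have "1 / real N \<le> c * (1 / u)"
    proof -
      have "1 * (1 / real N) \<le> 16/7 * (1 / real N)" by (intro mult_right_mono) auto
      then have "1 / real N \<le> 16/7 * (1 / real N)" by simp
      also have "\<dots> = c * (1 / (7/2 * s))" by (simp add: c_def power2_eq_square flip: s2)
      also have "\<dots> \<le> c * (1 / u)" using u s3 c by (intro mult_left_mono divide_left_mono mult_pos_pos) auto
      finally show ?thesis .
    qed
    moreover have "5 / real N = 5 * (1 / real N)" "4 / real N = 4 * (1 / real N)"
      "1 / (4 * real N) = 1/4 * (1 / real N)" "1 / real N \<ge> 0" by simp_all
    ultimately show "a (n + 1) - a n \<in> {1 / (4 * real N)..4 / real N}"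
      unfolding atLeastAtMost_iff by linarith
  next
    fix n assume n: "1 \<le> n \<and> n + 2 \<le> N"
    define z where "z = (real J)\<^sup>2 + real n"
    have "real n + 2 \<le> real N" using n by linarith
    then have z: "real N \<le> z" "z + 2 \<le> 3 * real N" using J2 of_nat_0_le_iff[of n] unfolding z_def by linarith+
    define p q r where "p = sqrt z" and "q = sqrt (z + 1)" and "r = sqrt (z + 2)"
    have pqr: "s \<le> p" "s \<le> q" "s \<le> r" "p \<le> 7/4 * s" "q \<le> 7/4 * s" "r \<le> 7/4 * s"
      using root[of z] root[of "z + 1"] root[of "z + 2"] z by (auto simp: p_def q_def r_def)
    define D where "D = (q + p) * (r + q) * (r + p)"
    \<comment> \<open>\<open>D\<close> lies between \<open>8 * s ^ 3\<close> and
      \<open>343/8 * s ^ 3\<close>, so the second difference \<open>c * (2 / D)\<close> is between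
      \<open>128/343\<close> and 2 times \<open>1 / N ^ 2\<close>.\<close>
    have D: "(2 * s) * (2 * s) * (2 * s) \<le> D" "D \<le> (7/2 * s) * (7/2 * s) * (7/2 * s)"
      unfolding D_def using pqr s3 by (intro mult_mono mult_nonneg_nonneg; linarith)+
    have D0: "D > 0" using pqr s3 unfolding D_def by (intro mult_pos_pos) linarith+
    have "z > 0" using z N by linarith
    have "(a (n + 2) - a (n + 1)) - (a (n + 1) - a n)
        = c * ((sqrt (z + 1) - sqrt z) - (sqrt (z + 2) - sqrt (z + 1)))"
      by (simp add: a_def z_def algebra_simps add_divide_distrib)
    then have eq: "(a (n + 2) - a (n + 1)) - (a (n + 1) - a n) = c * (2 / D)"
      unfolding D_def p_def q_def r_def sqrt_second_difference[OF \<open>z > 0\<close>] .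
    have N2: "(real N)\<^sup>2 = s * s * s * s" by (simp add: power2_eq_square flip: s2)
    have "c * (2 / D) \<le> c * (2 / ((2 * s) * (2 * s) * (2 * s)))"
      using D D0 s3 c by (intro mult_left_mono divide_left_mono mult_pos_pos) auto
    also have "\<dots> \<le> 4 / (real N)\<^sup>2" unfolding N2 using s3 by (simp add: c_def divide_simps)
    finally have le: "c * (2 / D) \<le> 4 / (real N)\<^sup>2" .
    have "1 / (4 * (real N)\<^sup>2) \<le> c * (2 / ((7/2 * s) * (7/2 * s) * (7/2 * s)))"
      unfolding N2 using s3 by (simp add: c_def divide_simps)
    also have "\<dots> \<le> c * (2 / D)"
      using D D0 s3 c by (intro mult_left_mono divide_left_mono mult_pos_pos) auto
    finally show "(a (n + 2) - a (n + 1)) - (a (n + 1) - a n) \<in> {1 / (4 * (real N)\<^sup>2)..4 / (real N)\<^sup>2}"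
      unfolding eq using le by simp
  qed
  define idx where "idx m = m\<^sup>2 + 2 * J * m" for m
  have inj: "inj_on idx {1..M}"
  proof (rule linorder_inj_onI)
    fix x y :: nat assume "x < y"
    then have "x\<^sup>2 < y\<^sup>2" "2 * J * x \<le> 2 * J * y" by (auto simp: power_strict_mono)
    then show "idx x \<noteq> idx y" unfolding idx_def by linarith
  qed auto
  have idx_range: "idx m \<in> {1..N}" if "m \<in> {1..M}" for m
  proof -
    have m: "real m \<le> s / 3" "m \<ge> 1" using that M by auto
    have "(real m)\<^sup>2 \<le> (s / 3)\<^sup>2" using m by (intro power_mono) auto
    moreover have "2 * real J * real m \<le> 2 * (s + 1) * (s / 3)"
      using m J s3 by (intro mult_mono) auto
    moreover have "(s / 3)\<^sup>2 + 2 * (s + 1) * (s / 3) \<le> s * s"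
    proof -
      have "3 * s \<le> s * s" using s3 by (intro mult_right_mono) auto
      moreover have "(s / 3)\<^sup>2 + 2 * (s + 1) * (s / 3) = s * s / 9 + 2 / 3 * (s * s) + 2 / 3 * s"
        by (simp add: power2_eq_square algebra_simps)
      ultimately show ?thesis by linarith
    qed
    ultimately have "real (idx m) \<le> s * s" unfolding idx_def by simp
    then have "real (idx m) \<le> real N" by (simp add: power2_eq_square flip: s2)
    moreover have "idx m \<ge> 1" using m unfolding idx_def by (simp add: trans_le_add1)
    ultimately show ?thesis by simp
  qed
  define b where "b n = (if n \<in> idx ` {1..M} then 1 else 0 :: complex)" for n
  have sumb: "(\<Sum>n=1..N. b n * g n) = (\<Sum>m=1..M. g (idx m))" for g
  proof -
    have "(\<Sum>n=1..N. b n * g n) = (\<Sum>n\<in>idx ` {1..M}. g n)"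
      using idx_range by (intro sum.mono_neutral_cong_right) (auto simp: b_def)
    also have "\<dots> = (\<Sum>m=1..M. g (idx m))" using inj by (simp add: sum.reindex)
    finally show ?thesis .
  qed
  have l2: "l2norm N b = sqrt (real M)"
  proof -
    have "complex_of_real (\<Sum>n=1..N. (cmod (b n))\<^sup>2) = (\<Sum>n=1..N. b n * 1)"
      unfolding of_real_sum by (intro sum.cong) (auto simp: b_def)
    also have "\<dots> = complex_of_real (real M)" unfolding sumb by simp
    finally show ?thesis unfolding l2norm_def by (simp only: of_real_eq_iff)
  qed
  have sq: "sqrt ((real J)\<^sup>2 + real (idx m)) = real J + real m" for m
    by (rule real_sqrt_unique) (simp_all add: idx_def power2_eq_square algebra_simps)
  define p where "p = 1 / c"
  have p: "p > 0" "c * p = 1" using c by (auto simp: p_def)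
  \<comment> \<open>For times up to \<open>\<delta>\<close> after a multiple of the period, the
    phases \<open>t * c * m\<close> with \<open>m\<close> up to \<open>M\<close> stay below
    \<open>1 / 8\<close>.\<close>
  define \<delta> where "\<delta> = 1 / (8 * c * real M)"
  have \<delta>: "0 \<le> \<delta>" "\<delta> \<le> p"
  proof -
    show "0 \<le> \<delta>" using c by (simp add: \<delta>_def)
    have "c * 1 \<le> c * (8 * real M)" using M c by (intro mult_left_mono) auto
    then show "\<delta> \<le> p" unfolding \<delta>_def p_def using c by (intro divide_left_mono) (auto simp: mult.left_commute mult.commute)
  qed
  have large: "(real M) ^ 4 / 4 \<le> maxfun N a b (t + real j * p) ^ 4" if "t \<in> {0..\<delta>}" for t j
  proof -
    define T where "T = t + real j * p"
    \<comment> \<open>\<open>x\<close> is \<open>-5 * T\<close> reduced modulo \<open>N\<close> into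
      the allowed range; the reduction changes the phase at index \<open>n\<close> by the integer
      \<open>k * n\<close>, while \<open>-5 * T\<close> cancels the linear part of
      \<open>a\<close>.\<close>
    define k where "k = \<lfloor>- 5 * T / real N\<rfloor>"
    define x where "x = - 5 * T - real N * of_int k"
    have Npos: "real N > 0" using N by simp
    have "of_int k \<le> - 5 * T / real N" "- 5 * T / real N \<le> of_int k + 1" unfolding k_def by linarith+
    then have x: "x \<in> {0..real N}" using Npos unfolding x_def by (auto simp: field_simps)
    have ph: "e (x * real (idx m) / real N + T * a (idx m)) = e (- (t * c * real J)) * e (- (t * c * real m))" for m
    proof -
      \<comment> \<open>Whole periods contribute \<open>j * (J + m)\<close> to the phase, an integer
        because the root is an integer at the selected indices.\<close>
      have "T * c = t * c + real j" unfolding T_def using p by (simp add: algebra_simps)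
      moreover have "x * real (idx m) / real N + T * a (idx m)
          = - of_int k * real (idx m) - T * c * (real J + real m)"
        unfolding a_def sq x_def using Npos by (simp add: field_simps)
      ultimately have "x * real (idx m) / real N + T * a (idx m)
          = of_int (- k * int (idx m) - int j * (int J + int m)) + (- (t * c * real J) + - (t * c * real m))"
        by (simp add: algebra_simps)
      then show ?thesis by (simp only: e_add e_of_int mult_1)
    qed
    have "real (card {1..M}) / sqrt 2 \<le> cmod (\<Sum>m\<in>{1..M}. e (- (t * c * real m)))"
    proof (rule norm_sum_e_ge)
      fix m assume "m \<in> {1..M}"
      then have "t * (c * real m) \<le> \<delta> * (c * real M)" using that c by (intro mult_mono) auto
      also have "\<dots> = 1 / 8" using c M by (simp add: \<delta>_def)
      finally show "\<bar>- (t * c * real m)\<bar> \<le> 1 / 8" using that c by (simp add: mult.assoc)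
    qed
    also have "\<dots> = cmod (expsum N a b T x)"
      unfolding expsum_def sumb ph by (simp add: norm_mult flip: sum_distrib_left)
    also have "\<dots> \<le> maxfun N a b T" by (rule norm_expsum_le_maxfun[OF x])
    finally have "(real M / sqrt 2) ^ 4 \<le> maxfun N a b T ^ 4" by (intro power_mono) auto
    moreover have "(real M / sqrt 2) ^ 4 = (real M) ^ 4 / 4"
    proof -
      have "sqrt 2 ^ 4 = (4 :: real)" using power_mult[of "sqrt 2" 2 2] by simp
      then show ?thesis by (simp add: power_divide)
    qed
    ultimately show ?thesis by (simp add: T_def)
  qed
  \<comment> \<open>The number of complete periods in the time interval; rounding down at most
    halves it.\<close>
  define n where "n = nat \<lfloor>(real N)\<^sup>2 * c\<rfloor>"
  have "1 \<le> (real N)\<^sup>2 * c"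
  proof -
    have "1 * (1 * 1) \<le> s * (s * s)" using s3 by (intro mult_mono) auto
    moreover have "(real N)\<^sup>2 * c = 8 * (s * (s * s))" using s3 by (simp add: c_def power2_eq_square flip: s2)
    ultimately show ?thesis by linarith
  qed
  moreover have "(w / 2 \<le> real (nat \<lfloor>w\<rfloor>)) \<and> real (nat \<lfloor>w\<rfloor>) \<le> w" if "1 \<le> w" for w :: real
  proof -
    have "1 \<le> \<lfloor>w\<rfloor>" using that by simp
    then have "real (nat \<lfloor>w\<rfloor>) = of_int \<lfloor>w\<rfloor>" "(1 :: real) \<le> of_int \<lfloor>w\<rfloor>" by simp_all
    then show ?thesis by linarith
  qed
  ultimately have n: "real n \<le> (real N)\<^sup>2 * c" "(real N)\<^sup>2 * c / 2 \<le> real n"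
    unfolding n_def by blast+
  define I where "I = integral {0..(real N)\<^sup>2} (\<lambda>t. maxfun N a b t ^ 4)"
  have cont: "continuous_on S (\<lambda>t. maxfun N a b t ^ 4)" for S
    by (intro continuous_intros continuous_on_maxfun)
  have cont': "continuous_on S (\<lambda>t. \<Sum>j<n. maxfun N a b (t + real j * p) ^ 4)" for S
    by (intro continuous_intros continuous_on_compose2[OF continuous_on_maxfun[of UNIV]]) auto
  have I: "(real N)\<^sup>2 * real M ^ 3 / 64 \<le> I"
  proof -
    have "(real N)\<^sup>2 * real M ^ 3 / 64 = ((real N)\<^sup>2 * c / 2) * (\<delta> * (real M ^ 4 / 4))"
      using c M by (simp add: \<delta>_def eval_nat_numeral)
    also have "\<dots> \<le> real n * (\<delta> * (real M ^ 4 / 4))"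
      using n \<delta> by (intro mult_right_mono mult_nonneg_nonneg) auto
    also have "\<dots> = integral {0..\<delta>} (\<lambda>t. \<Sum>j<n. real M ^ 4 / 4)"
      using \<delta> by simp
    also have "\<dots> \<le> integral {0..\<delta>} (\<lambda>t. \<Sum>j<n. maxfun N a b (t + real j * p) ^ 4)"
      by (intro integral_le integrable_continuous_real continuous_intros cont' sum_mono large) auto
    also have "\<dots> \<le> integral {0..p} (\<lambda>t. \<Sum>j<n. maxfun N a b (t + real j * p) ^ 4)"
      using \<delta> by (intro integral_subset_le integrable_continuous_real cont') (auto intro!: sum_nonneg)
    also have "\<dots> = integral {0..real n * p} (\<lambda>t. maxfun N a b t ^ 4)"
      using p by (intro integral_periods[symmetric] cont) auto
    also have "\<dots> \<le> I"
    proof -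
      have "real n * p \<le> (real N)\<^sup>2 * c * p" using n p by (intro mult_right_mono) auto
      also have "\<dots> = (real N)\<^sup>2" using p by simp
      finally show ?thesis unfolding I_def
        by (intro integral_subset_le integrable_continuous_real cont) auto
    qed
    finally show ?thesis .
  qed
  define X where "X = 1 / 8 * real N powr (5/8) * sqrt (real M)"
  have X0: "X \<ge> 0" by (simp add: X_def)
  have "X ^ 4 \<le> I"
  proof -
    have r1: "(real N powr (5/8)) ^ 4 = (real N)\<^sup>2 * s"
    proof -
      have "(real N powr (5/8)) ^ 4 = real N powr (2 + 1/2)" using N by (simp add: powr_power)
      also have "\<dots> = real N powr 2 * real N powr (1/2)" by (rule powr_add)
      finally show ?thesis using N by (simp add: s_def powr_half_sqrt)
    qed
    have r2: "sqrt (real M) ^ 4 = (real M)\<^sup>2"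
      using power_mult[of "sqrt (real M)" 2 2] by simp
    have "X ^ 4 = ((real N)\<^sup>2 * (real M)\<^sup>2) * (s / 4096)"
      unfolding X_def power_mult_distrib r1 r2 by (simp add: power_divide)
    \<comment> \<open>The constant \<open>1 / 8\<close> enters as \<open>1 / 4096\<close>;
      \<open>s \<le> 6 * M\<close> leaves ample room.\<close>
    also have "\<dots> \<le> ((real N)\<^sup>2 * (real M)\<^sup>2) * (real M / 64)"
      using Ms by (intro mult_left_mono) auto
    also have "\<dots> = (real N)\<^sup>2 * real M ^ 3 / 64" by (simp add: power2_eq_square power3_eq_cube)
    finally show ?thesis using I by linarith
  qed
  then have "(X ^ 4) powr (1/4) \<le> I powr (1/4)" using X0 by (intro powr_mono2) auto
  moreover have "(X ^ 4) powr (1/4) = X" using X0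
    by (cases "X = 0") (auto simp: powr_powr simp flip: powr_numeral)
  ultimately have "X \<le> L4norm N a b" unfolding L4norm_eq I_def by simp
  then show ?thesis using uc l2 M unfolding X_def by (intro exI[of _ a] exI[of _ b]) auto
qed

text \<open>The clause \<open>l2norm N b > 0\<close> keeps the first part from being met by zero
  coefficients, for which both sides vanish.\<close>

theorem theorem2:
  shows "(\<exists>C>0. \<forall>N::nat. N \<ge> 10 \<longrightarrow>
            (\<exists>a b. uniformly_convex N a \<and> l2norm N b > 0 \<and>
                L4norm N a b \<ge> C * real N powr (5/8) * l2norm N b))
       \<and> (\<forall>\<epsilon>>0. \<exists>C>0. \<forall>N::nat. N \<ge> 1 \<longrightarrow> (\<forall>a b. uniformly_convex N a \<longrightarrow>
            L4norm N a b \<le> C * real N powr \<epsilon> * real N powr (2/3) * l2norm N b))"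
proof (intro conjI allI impI)
  show "\<exists>C>0. \<forall>N::nat. N \<ge> 10 \<longrightarrow> (\<exists>a b. uniformly_convex N a \<and> l2norm N b > 0 \<and>
                L4norm N a b \<ge> C * real N powr (5/8) * l2norm N b)"
    by (rule exI[of _ "1 / 8"]) (use maximal_lower_bound in auto)
next
  fix \<epsilon> :: real assume "\<epsilon> > 0"
  then show "\<exists>C>0. \<forall>N::nat. N \<ge> 1 \<longrightarrow> (\<forall>a b. uniformly_convex N a \<longrightarrow>
            L4norm N a b \<le> C * real N powr \<epsilon> * real N powr (2/3) * l2norm N b)"
    by (rule maximal_upper_bound)
qed

end
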